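(* Let $n\ge 4$ be an integer, let $m\le\lfloor n/2\rfloor$ be a positive integer, let $c\in[0,1]$, and let $$\sigma(c,m)=\sqrt{c}\sum_{i=1}^{m}e_{ii}+\sum_{i=m+1}^{n-m}e_{ii}+\sqrt{c}\sum_{i=n-m+1}^{n}e_{ii}+\sqrt{1-c}\sum_{i=1}^{m}(e_{n+1-i,i}-e_{i,n+1-i}).$$ Then the subgroup $\operatorname{Ad}_{\sigma(c,m)}(U(n-m)\times U(m))$ is coisotropic in $U(n)$ (with its standard Poisson--Lie structure), and likewise $\operatorname{Ad}_{\sigma(c,m)}S(U(n-m)\times U(m))$ is coisotropic in the standard Poisson--Lie group $SU(n)$.
   Context: $e_{ij}$ are the standard $n\times n$ matrix units, and $\operatorname{Ad}_\sigma K=\sigma K\sigma^{-1}$. $U(n-m)\times U(m)$ is embedded in $U(n)$ by $(A,B)\mapsto\begin{pmatrix}A&0\\0&B\end{pmatrix}$, and $S(U(n-m)\times U(m))$ is its intersection with $SU(n)$. The standard Poisson--Lie structure on $G=SU(n)$ (or $U(n)$) is, up to a constant factor, $\pi(g)=L_gr-R_gr$, where $L_g,R_g$ denote left and right translations (and the induced maps on bivectors) and $r=\sum_{1\le i<j\le n}X^+_{ij}\wedge X^-_{ij}$ with $X^+_{ij}=\sqrt{-1}\,(e_{ij}+e_{ji})$, $X^-_{ij}=e_{ij}-e_{ji}$. A closed subgroup $K$ with Lie algebra $\mathfrak k$ of a Poisson--Lie group $(G,\pi)$ with Lie algebra $\mathfrak g$ is coisotropic if $\pi(k)\in L_k(\mathfrak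 k\wedge\mathfrak g)$ for all $k\in K$, where $\mathfrak k\wedge\mathfrak g\subseteq\wedge^2\mathfrak g$ is the span of $x\wedge y$ with $x\in\mathfrak k$, $y\in\mathfrak g$. *)

theory Defs
  imports
    Complex_Main
    "HOL-Library.Function_Algebras"
    Jordan_Normal_Form.Schur_Decomposition
begin

(* 1-based indices, as usual in mathematics; matrix entries ($$) are 0-based. *)
definition matrix_unit :: "nat \<Rightarrow> nat \<Rightarrow> nat \<Rightarrow> complex mat" where
  "matrix_unit n i j = mat n n (\<lambda>(a, b). if Suc a = i \<and> Suc b = j then 1 else 0)"

(* The type of matrices of all sizes has no zero, so "sum" is not available for it. *)
definition mat_sum :: "nat \<Rightarrow> ('i \<Rightarrow> complex mat) \<Rightarrow> 'i set \<Rightarrow> complex mat" where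
  "mat_sum n f I = mat n n (\<lambda>ab. \<Sum>i\<in>I. f i $$ ab)"

definition \<sigma>_mat :: "nat \<Rightarrow> real \<Rightarrow> nat \<Rightarrow> complex mat" where
  "\<sigma>_mat n c m =
     complex_of_real (sqrt c) \<cdot>\<^sub>m mat_sum n (\<lambda>i. matrix_unit n i i) {1..m}
   + mat_sum n (\<lambda>i. matrix_unit n i i) {m+1..n-m}
   + complex_of_real (sqrt c) \<cdot>\<^sub>m mat_sum n (\<lambda>i. matrix_unit n i i) {n-m+1..n}
   + complex_of_real (sqrt (1 - c)) \<cdot>\<^sub>m
       mat_sum n (\<lambda>i. matrix_unit n (n+1-i) i - matrix_unit n i (n+1-i)) {1..m}"

subsection \<open>Unitary groups\<close>

definition U_group :: "nat \<Rightarrow> complex mat monoid" where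
  "U_group n = \<lparr>carrier = {A \<in> carrier_mat n n. mat_adjoint A * A = 1\<^sub>m n},
                monoid.mult = (*), one = 1\<^sub>m n\<rparr>"

definition SU_group :: "nat \<Rightarrow> complex mat monoid" where
  "SU_group n = \<lparr>carrier = {A \<in> carrier (U_group n). det A = 1},
                 monoid.mult = (*), one = 1\<^sub>m n\<rparr>"

definition block_U :: "nat \<Rightarrow> nat \<Rightarrow> complex mat set" where
  "block_U n m = {four_block_mat A (0\<^sub>m (n-m) m) (0\<^sub>m m (n-m)) B | A B.
                    A \<in> carrier (U_group (n-m)) \<and> B \<in> carrier (U_group m)}"

definition block_SU :: "nat \<Rightarrow> nat \<Rightarrow> complex mat set" where
  "block_SU n m = block_U n m \<inter> carrier (SU_group n)"

definition Ad :: "nat \<Rightarrow> complex mat \<Rightarrow> complex mat set \<Rightarrow> complex mat set" where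
  "Ad n \<sigma> K = (\<lambda>k. \<sigma> * k * inv\<^bsub>U_group n\<^esub> \<sigma>) ` K"

(* Closedness is sequential closedness in G for entrywise convergence of matrices. *)
definition closed_subgroup :: "nat \<Rightarrow> complex mat set \<Rightarrow> complex mat monoid \<Rightarrow> bool" where
  "closed_subgroup n K G \<longleftrightarrow> subgroup K G \<and>
     (\<forall>X A. (\<forall>k. X k \<in> K) \<longrightarrow> A \<in> carrier G \<longrightarrow>
        (\<forall>i<n. \<forall>j<n. (\<lambda>k. X k $$ (i, j)) \<longlonglongrightarrow> A $$ (i, j)) \<longrightarrow> A \<in> K)"

(* The Lie algebra of a closed group K of n x n matrices is the tangent space of K at the
   identity: the initial velocities of C^1 curves in K starting at the identity. *)
definition lie_algebra :: "nat \<Rightarrow> complex mat set \<Rightarrow> complex mat set" where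
  "lie_algebra n K = {X \<in> carrier_mat n n.
     \<exists>\<gamma> \<gamma>' :: real \<Rightarrow> complex mat.
       (\<forall>t. \<gamma> t \<in> K) \<and> \<gamma> 0 = 1\<^sub>m n \<and> \<gamma>' 0 = X \<and>
       (\<forall>i<n. \<forall>j<n.
          (\<forall>t. ((\<lambda>s. \<gamma> s $$ (i, j)) has_vector_derivative \<gamma>' t $$ (i, j)) (at t)) \<and>
          continuous_on UNIV (\<lambda>t. \<gamma>' t $$ (i, j)))}"

subsection \<open>Bivectors\<close>

(* All tangent spaces of the matrix groups are real subspaces of the space V of complex
   n x n matrices, so every bivector lives in the exterior square of the real vector space V.
   That exterior square is realised as the alternating bilinear forms on the dual space of V;
   values at arguments that are not linear functionals on V are set to 0. *)

definition real_functional :: "nat \<Rightarrow> (complex mat \<Rightarrow> real) \<Rightarrow> bool" where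
  "real_functional n \<phi> \<longleftrightarrow>
     (\<forall>X\<in>carrier_mat n n. \<forall>Y\<in>carrier_mat n n. \<phi> (X + Y) = \<phi> X + \<phi> Y) \<and>
     (\<forall>a :: real. \<forall>X\<in>carrier_mat n n. \<phi> (complex_of_real a \<cdot>\<^sub>m X) = a * \<phi> X)"

type_synonym bivector = "(complex mat \<Rightarrow> real) \<Rightarrow> (complex mat \<Rightarrow> real) \<Rightarrow> real"

definition bivector_scale :: "real \<Rightarrow> bivector \<Rightarrow> bivector" where
  "bivector_scale a \<beta> = (\<lambda>\<phi> \<psi>. a * \<beta> \<phi> \<psi>)"

interpretation bivector: vector_space bivector_scale
  by unfold_locales (auto simp: bivector_scale_def fun_eq_iff algebra_simps)

definition wedge :: "nat \<Rightarrow> complex mat \<Rightarrow> complex mat \<Rightarrow> bivector" where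
  "wedge n X Y = (\<lambda>\<phi> \<psi>. if real_functional n \<phi> \<and> real_functional n \<psi>
                        then \<phi> X * \<psi> Y - \<phi> Y * \<psi> X else 0)"

(* The map induced on bivectors by a real-linear map f on matrices:
   it sends wedge n X Y to wedge n (f X) (f Y). *)
definition push_bivector :: "nat \<Rightarrow> (complex mat \<Rightarrow> complex mat) \<Rightarrow> bivector \<Rightarrow> bivector" where
  "push_bivector n f \<beta> = (\<lambda>\<phi> \<psi>. if real_functional n \<phi> \<and> real_functional n \<psi>
                                then \<beta> (\<phi> \<circ> f) (\<psi> \<circ> f) else 0)"

definition L_trans :: "nat \<Rightarrow> complex mat \<Rightarrow> bivector \<Rightarrow> bivector" where
  "L_trans n g = push_bivector n (\<lambda>X. g * X)"

definition R_trans :: "nat \<Rightarrow> complex mat \<Rightarrow> bivector \<Rightarrow> bivector" where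
  "R_trans n g = push_bivector n (\<lambda>X. X * g)"

definition wedge_space :: "nat \<Rightarrow> complex mat set \<Rightarrow> complex mat set \<Rightarrow> bivector set" where
  "wedge_space n \<kk> \<gg> = bivector.span {wedge n x y | x y. x \<in> \<kk> \<and> y \<in> \<gg>}"

subsection \<open>Standard Poisson--Lie structure and coisotropic subgroups\<close>

definition X_plus :: "nat \<Rightarrow> nat \<Rightarrow> nat \<Rightarrow> complex mat" where
  "X_plus n i j = \<i> \<cdot>\<^sub>m (matrix_unit n i j + matrix_unit n j i)"

definition X_minus :: "nat \<Rightarrow> nat \<Rightarrow> nat \<Rightarrow> complex mat" where
  "X_minus n i j = matrix_unit n i j - matrix_unit n j i"

definition r_standard :: "nat \<Rightarrow> bivector" where
  "r_standard n = (\<Sum>(i, j) \<in> {(i, j). 1 \<le> i \<and> i < j \<and> j \<le> n}.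
                     wedge n (X_plus n i j) (X_minus n i j))"

(* The same formula serves U(n) and SU(n). The structure is fixed only up to the choice of a
   nonzero constant factor \<kappa>. *)
definition standard_poisson :: "real \<Rightarrow> nat \<Rightarrow> complex mat \<Rightarrow> bivector" where
  "standard_poisson \<kappa> n g =
     bivector_scale \<kappa> (L_trans n g (r_standard n) - R_trans n g (r_standard n))"

definition coisotropic ::
  "nat \<Rightarrow> complex mat monoid \<Rightarrow> (complex mat \<Rightarrow> bivector) \<Rightarrow> complex mat set \<Rightarrow> bool" where
  "coisotropic n G \<pi> K \<longleftrightarrow> closed_subgroup n K G \<and>
     (\<forall>k\<in>K. \<pi> k \<in> L_trans n k `
        wedge_space n (lie_algebra n K) (lie_algebra n (carrier G)))"

end

(* Conjugation turns both subgroups into centralizers of the hermitian projection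
   Q = sigma * diag(1,...,1,0,...,0) * sigma^*, which makes them closed subgroups, and spectral
   theory puts every traceless antihermitian matrix commuting with Q into their Lie algebras k.
   Modulo k wedge g a bivector depends only on its values at functionals vanishing on k, that is, at
   antihermitian matrices P, P' that are off-diagonal with respect to Q. There the standard bivector
   r takes the value Im (sum over i < j of P_ij * conj P'_ij), and grouping the pairs (i, j) into
   orbits under i |-> n + 1 - i shows that this equals (2c - 1) Im tr (Q P P'^* ). The latter
   is invariant under conjugation by the centralizer of Q, so r - Ad_(k^-1) r lies in k wedge g. *)

theory Submission
  imports Defs
begin

subsection \<open>Adjoints, traces and unitary groups\<close>

text \<open>In the plane of the basis vectors \<open>i\<close> and \<open>n + 1 - i\<close> with
  \<open>i \<le> m\<close>, \<sigma> is a rotation with cosine \<open>sqrt c\<close> and sine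
  \<open>sqrt (1 - c)\<close>. Conjugation by \<sigma> therefore mixes an entry only with entries at
  reflected positions, which is why the orbits of the reflection are the natural groups of terms.
  The constant arises in two ways: orbits with one index fixed by \<sigma> give
  \<open>c - (1 - c)\<close>, those with both indices rotated give \<open>c^2 - (1 - c)^2\<close>,
  and the two agree because \<open>c + (1 - c) = 1\<close>. The obstacle is that the sum over
  \<open>i < j\<close> depends on the order of the basis, while the conjugating element is an
  arbitrary member of the centralizer; the trace expression no longer sees the order. Lower bounds
  for the Lie algebras suffice, since \<open>wedge_space\<close> is monotone in both arguments, and
  because all \<open>X_plus\<close> and \<open>X_minus\<close> with distinct indices are traceless,
  the same tangent vectors serve U(n) and SU(n).\<close>

lemma adjoint_carrier [simp, intro]:
  "A \<in> carrier_mat r c \<Longrightarrow> mat_adjoint A \<in> carrier_mat c r"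
  by (auto simp: mat_adjoint_def mat_of_rows_def)

lemma adjoint_dim [simp]:
  "dim_row (mat_adjoint A) = dim_col A" "dim_col (mat_adjoint A) = dim_row A"
  by (auto simp: mat_adjoint_def mat_of_rows_def)

lemma adjoint_index [simp]:
  fixes A :: "complex mat"
  shows "i < dim_col A \<Longrightarrow> j < dim_row A \<Longrightarrow> mat_adjoint A $$ (i, j) = cnj (A $$ (j, i))"
  by (auto simp: mat_adjoint_def mat_of_rows_def)

lemma adjoint_adjoint [simp]: "mat_adjoint (mat_adjoint A) = (A :: complex mat)"
  by (rule eq_matI) auto

lemma adjoint_one [simp]: "mat_adjoint (1\<^sub>m n) = (1\<^sub>m n :: complex mat)"
  by (rule eq_matI) auto

lemma adjoint_uminus [simp]: "mat_adjoint (- A) = - mat_adjoint (A :: complex mat)"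
  by (rule eq_matI) auto

lemma adjoint_add:
  fixes A B :: "complex mat"
  shows "A \<in> carrier_mat r c \<Longrightarrow> B \<in> carrier_mat r c \<Longrightarrow>
    mat_adjoint (A + B) = mat_adjoint A + mat_adjoint B"
  by (rule eq_matI) auto

lemma adjoint_minus:
  fixes A B :: "complex mat"
  shows "A \<in> carrier_mat r c \<Longrightarrow> B \<in> carrier_mat r c \<Longrightarrow>
    mat_adjoint (A - B) = mat_adjoint A - mat_adjoint B"
  by (rule eq_matI) auto

lemma index_mult_sum:
  assumes "A \<in> carrier_mat r k" "B \<in> carrier_mat k c" "i < r" "j < c"
  shows "(A * B) $$ (i, j) = (\<Sum>l<k. A $$ (i, l) * B $$ (l, j))"
  using assms by (auto simp: scalar_prod_def lessThan_atLeast0)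

lemma adjoint_mult:
  fixes A B :: "complex mat"
  assumes "A \<in> carrier_mat r k" "B \<in> carrier_mat k c"
  shows "mat_adjoint (A * B) = mat_adjoint B * mat_adjoint A"
proof (rule eq_matI)
  fix i j assume "i < dim_row (mat_adjoint B * mat_adjoint A)" "j < dim_col (mat_adjoint B * mat_adjoint A)"
  then show "mat_adjoint (A * B) $$ (i, j) = (mat_adjoint B * mat_adjoint A) $$ (i, j)"
    using assms by (auto simp: scalar_prod_def mult.commute intro!: sum.cong)
qed (use assms in auto)

lemma adjoint_diag: "mat_adjoint (mat_diag n f) = mat_diag n (\<lambda>i. cnj (f i))"
  by (rule eq_matI) (auto simp: mat_diag_def)

lemma det_diag: "det (mat_diag n f) = (\<Prod>i<n. f i)"
  by (subst det_upper_triangular[of _ n])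
    (auto simp: mat_diag_def diag_mat_def prod.list_conv_set_nth lessThan_atLeast0 intro!: upper_triangularI)

definition mat_trace :: "complex mat \<Rightarrow> complex" where
  "mat_trace A = (\<Sum>i<dim_row A. A $$ (i, i))"

lemma trace_mult_commute:
  assumes "A \<in> carrier_mat r k" "B \<in> carrier_mat k r"
  shows "mat_trace (A * B) = mat_trace (B * A)"
proof -
  have "mat_trace (A * B) = (\<Sum>i<r. \<Sum>l<k. A $$ (i, l) * B $$ (l, i))"
    using assms by (auto simp: mat_trace_def index_mult_sum[OF assms] simp del: index_mult_mat(1))
  also have "\<dots> = (\<Sum>l<k. \<Sum>i<r. A $$ (i, l) * B $$ (l, i))" by (rule sum.swap)
  also have "\<dots> = mat_trace (B * A)"
    using assms by (auto simp: mat_trace_def index_mult_sum[OF assms(2,1)] mult.commute simp del: index_mult_mat(1))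
  finally show ?thesis .
qed

lemma trace_minus:
  "A \<in> carrier_mat n n \<Longrightarrow> B \<in> carrier_mat n n \<Longrightarrow> mat_trace (A - B) = mat_trace A - mat_trace B"
  by (auto simp: mat_trace_def sum_subtractf)

lemma trace_add:
  "A \<in> carrier_mat n n \<Longrightarrow> B \<in> carrier_mat n n \<Longrightarrow> mat_trace (A + B) = mat_trace A + mat_trace B"
  by (auto simp: mat_trace_def sum.distrib)

lemma U_group_simps [simp]: "monoid.mult (U_group n) = (*)" "one (U_group n) = 1\<^sub>m n"
  by (auto simp: U_group_def)

lemma SU_group_simps [simp]: "monoid.mult (SU_group n) = (*)" "one (SU_group n) = 1\<^sub>m n"
  by (auto simp: SU_group_def)

lemma mem_SU_iff: "A \<in> carrier (SU_group n) \<longleftrightarrow> A \<in> carrier (U_group n) \<and> det A = 1"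
  by (auto simp: SU_group_def)

lemma mem_U_iff: "A \<in> carrier (U_group n) \<longleftrightarrow> A \<in> carrier_mat n n \<and> mat_adjoint A * A = 1\<^sub>m n"
  by (auto simp: U_group_def)

lemma unitaryI: "A \<in> carrier_mat n n \<Longrightarrow> mat_adjoint A * A = 1\<^sub>m n \<Longrightarrow> A \<in> carrier (U_group n)"
  by (simp add: mem_U_iff)

lemma unitary_carrier: "A \<in> carrier (U_group n) \<Longrightarrow> A \<in> carrier_mat n n"
  by (simp add: mem_U_iff)

lemma unitary_adjoint_left [simp]: "A \<in> carrier (U_group n) \<Longrightarrow> mat_adjoint A * A = 1\<^sub>m n"
  by (simp add: mem_U_iff)

lemma unitary_adjoint_right [simp]:
  assumes "A \<in> carrier (U_group n)"
  shows "A * mat_adjoint A = 1\<^sub>m n"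
  using unitary_carrier[OF assms] assms by (intro mat_mult_left_right_inverse[of "mat_adjoint A"]) auto

lemma unitary_cancel:
  assumes "A \<in> carrier (U_group n)" "B \<in> carrier_mat n k"
  shows "A * (mat_adjoint A * B) = B" "mat_adjoint A * (A * B) = B"
  using assms unitary_carrier[OF assms(1)]
    assoc_mult_mat[of A n n "mat_adjoint A" n B k] assoc_mult_mat[of "mat_adjoint A" n n A n B k]
  by simp_all

lemma unitary_one: "1\<^sub>m n \<in> carrier (U_group n)"
  by (rule unitaryI) auto

lemma unitary_adjoint:
  assumes "A \<in> carrier (U_group n)"
  shows "mat_adjoint A \<in> carrier (U_group n)"
  using unitary_carrier[OF assms] assms by (intro unitaryI) auto

lemma unitary_mult:
  assumes "A \<in> carrier (U_group n)" "B \<in> carrier (U_group n)"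
  shows "A * B \<in> carrier (U_group n)"
  using assms unitary_carrier[OF assms(1)] unitary_carrier[OF assms(2)]
  by (intro unitaryI)
    (auto simp: adjoint_mult[of _ n n _ n] assoc_mult_mat[of _ n n _ n _ n] unitary_cancel[where k = n])

lemma det_unitary:
  assumes "A \<in> carrier (U_group n)"
  shows "det (mat_adjoint A) * det A = 1"
  using assms unitary_carrier[OF assms] det_mult[of "mat_adjoint A" n A] by simp

lemma SU_unitary: "A \<in> carrier (SU_group n) \<Longrightarrow> A \<in> carrier (U_group n)"
  by (simp add: mem_SU_iff)

lemma SU_one: "1\<^sub>m n \<in> carrier (SU_group n)"
  by (simp add: mem_SU_iff unitary_one)

lemma SU_mult:
  assumes "A \<in> carrier (SU_group n)" "B \<in> carrier (SU_group n)"
  shows "A * B \<in> carrier (SU_group n)"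
  using assms det_mult[OF unitary_carrier unitary_carrier, OF SU_unitary SU_unitary, OF assms]
  by (simp add: mem_SU_iff unitary_mult)

lemma SU_adjoint: "A \<in> carrier (SU_group n) \<Longrightarrow> mat_adjoint A \<in> carrier (SU_group n)"
  using det_unitary[of A n] by (simp add: mem_SU_iff unitary_adjoint)

lemma U_group: "group (U_group n)"
proof (rule groupI)
  fix A assume A: "A \<in> carrier (U_group n)"
  show "\<one>\<^bsub>U_group n\<^esub> \<otimes>\<^bsub>U_group n\<^esub> A = A" using unitary_carrier[OF A] by simp
  show "\<exists>B\<in>carrier (U_group n). B \<otimes>\<^bsub>U_group n\<^esub> A = \<one>\<^bsub>U_group n\<^esub>"
    using A by (intro bexI[OF _ unitary_adjoint]) auto
next
  fix A B C assume "A \<in> carrier (U_group n)" "B \<in> carrier (U_group n)" "C \<in> carrier (U_group n)"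
  note this[THEN unitary_carrier]
  then show "A \<otimes>\<^bsub>U_group n\<^esub> B \<otimes>\<^bsub>U_group n\<^esub> C = A \<otimes>\<^bsub>U_group n\<^esub> (B \<otimes>\<^bsub>U_group n\<^esub> C)"
    by simp
qed (simp_all add: unitary_mult unitary_one)

lemma SU_group: "group (SU_group n)"
proof (rule groupI)
  fix A assume A: "A \<in> carrier (SU_group n)"
  show "\<one>\<^bsub>SU_group n\<^esub> \<otimes>\<^bsub>SU_group n\<^esub> A = A"
    using unitary_carrier[OF SU_unitary[OF A]] by simp
  show "\<exists>B\<in>carrier (SU_group n). B \<otimes>\<^bsub>SU_group n\<^esub> A = \<one>\<^bsub>SU_group n\<^esub>"
    using A by (intro bexI[OF _ SU_adjoint]) (auto dest: SU_unitary)
next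
  fix A B C assume "A \<in> carrier (SU_group n)" "B \<in> carrier (SU_group n)" "C \<in> carrier (SU_group n)"
  note this[THEN SU_unitary, THEN unitary_carrier]
  then show "A \<otimes>\<^bsub>SU_group n\<^esub> B \<otimes>\<^bsub>SU_group n\<^esub> C = A \<otimes>\<^bsub>SU_group n\<^esub> (B \<otimes>\<^bsub>SU_group n\<^esub> C)"
    by simp
qed (simp_all add: SU_mult SU_one)

lemma inv_U_group: "A \<in> carrier (U_group n) \<Longrightarrow> inv\<^bsub>U_group n\<^esub> A = mat_adjoint A"
  by (rule group.inv_equality[OF U_group]) (auto simp: unitary_adjoint)

lemma inv_SU_group: "A \<in> carrier (SU_group n) \<Longrightarrow> inv\<^bsub>SU_group n\<^esub> A = mat_adjoint A"
  by (rule group.inv_equality[OF SU_group]) (auto simp: SU_adjoint dest: SU_unitary)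

section \<open>Centralizers as closed subgroups\<close>

definition centralizer :: "complex mat monoid \<Rightarrow> complex mat \<Rightarrow> complex mat set" where
  "centralizer G Q = {k \<in> carrier G. k * Q = Q * k}"

lemma adjoint_commute:
  assumes A: "A \<in> carrier (U_group n)" and Q: "Q \<in> carrier_mat n n" and comm: "A * Q = Q * A"
  shows "mat_adjoint A * Q = Q * mat_adjoint A"
proof -
  note Ac = unitary_carrier[OF A]
  have "mat_adjoint A * Q = mat_adjoint A * (Q * A) * mat_adjoint A"
    using A Ac Q by (simp add: assoc_mult_mat[of _ n n _ n _ n])
  also have "\<dots> = Q * mat_adjoint A"
    using A Ac Q by (simp add: assoc_mult_mat[of _ n n _ n _ n] unitary_cancel[where k = n] flip: comm)
  finally show ?thesis .
qed

lemma mult_commute_with: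
  assumes "A \<in> carrier_mat n n" "B \<in> carrier_mat n n" "Q \<in> carrier_mat n n" "A * Q = Q * A" "B * Q = Q * B"
  shows "A * B * Q = Q * (A * B)"
proof -
  have "A * B * Q = A * Q * B"
    using assms(1-3) by (simp add: assoc_mult_mat[of _ n n _ n _ n] assms(5))
  also have "\<dots> = Q * (A * B)"
    using assms(1-3) by (simp add: assoc_mult_mat[of _ n n _ n _ n] assms(4))
  finally show ?thesis .
qed

text \<open>The entries of \<open>X k * Q\<close> and \<open>Q * X k\<close> are finite sums of
  entries of \<open>X k\<close> with constant coefficients, so the commutation relation survives
  entrywise limits.\<close>

lemma centralizer_closed:
  assumes "Q \<in> carrier_mat n n" and sub: "carrier G \<subseteq> carrier_mat n n"
    and X: "\<And>k :: nat. X k \<in> centralizer G Q" and A: "A \<in> carrier G"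
    and lim: "\<And>i j. i < n \<Longrightarrow> j < n \<Longrightarrow> (\<lambda>k. X k $$ (i, j)) \<longlonglongrightarrow> A $$ (i, j)"
  shows "A \<in> centralizer G Q"
proof -
  have Ac: "A \<in> carrier_mat n n" and Xc: "X k \<in> carrier_mat n n" for k
    using A sub X by (auto simp: centralizer_def)
  have "A * Q = Q * A"
  proof (rule eq_matI)
    fix i j assume "i < dim_row (Q * A)" "j < dim_col (Q * A)"
    then have ij: "i < n" "j < n" using assms(1) Ac by auto
    have "(\<lambda>k. (X k * Q) $$ (i, j)) \<longlonglongrightarrow> (A * Q) $$ (i, j)"
      unfolding index_mult_sum[OF Xc assms(1) ij] index_mult_sum[OF Ac assms(1) ij]
      using ij by (intro tendsto_intros lim) auto
    moreover have "(\<lambda>k. (Q * X k) $$ (i, j)) \<longlonglongrightarrow> (Q * A) $$ (i, j)"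
      unfolding index_mult_sum[OF assms(1) Xc ij] index_mult_sum[OF assms(1) Ac ij]
      using ij by (intro tendsto_intros lim) auto
    moreover have "X k * Q = Q * X k" for k using X[of k] by (simp add: centralizer_def)
    ultimately show "(A * Q) $$ (i, j) = (Q * A) $$ (i, j)"
      using LIMSEQ_unique by auto
  qed (use assms(1) Ac in auto)
  then show ?thesis using A by (simp add: centralizer_def)
qed

lemma closed_subgroup_centralizer_U:
  assumes Q: "Q \<in> carrier_mat n n"
  shows "closed_subgroup n (centralizer (U_group n) Q) (U_group n)"
  unfolding closed_subgroup_def
proof (intro conjI allI impI)
  show "subgroup (centralizer (U_group n) Q) (U_group n)"
  proof (rule subgroup.intro)
    fix A B assume "A \<in> centralizer (U_group n) Q" "B \<in> centralizer (U_group n) Q"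
    then show "A \<otimes>\<^bsub>U_group n\<^esub> B \<in> centralizer (U_group n) Q"
      using mult_commute_with[OF unitary_carrier unitary_carrier Q, of A B] by (simp add: centralizer_def unitary_mult)
  next
    fix A assume "A \<in> centralizer (U_group n) Q"
    then show "inv\<^bsub>U_group n\<^esub> A \<in> centralizer (U_group n) Q"
      using adjoint_commute[OF _ Q, of A] by (simp add: centralizer_def inv_U_group unitary_adjoint)
  qed (use Q in \<open>auto simp: centralizer_def unitary_one\<close>)
next
  fix X A assume h: "\<forall>k. X k \<in> centralizer (U_group n) Q" "A \<in> carrier (U_group n)"
    "\<forall>i<n. \<forall>j<n. (\<lambda>k. X k $$ (i, j)) \<longlonglongrightarrow> A $$ (i, j)"
  show "A \<in> centralizer (U_group n) Q"
    by (rule centralizer_closed[OF Q _ _ _, where X = X, OF subsetI]) (use h in \<open>blast intro: unitary_carrier\<close>)+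
qed

lemma closed_subgroup_centralizer_SU:
  assumes Q: "Q \<in> carrier_mat n n"
  shows "closed_subgroup n (centralizer (SU_group n) Q) (SU_group n)"
  unfolding closed_subgroup_def
proof (intro conjI allI impI)
  show "subgroup (centralizer (SU_group n) Q) (SU_group n)"
  proof (rule subgroup.intro)
    fix A B assume "A \<in> centralizer (SU_group n) Q" "B \<in> centralizer (SU_group n) Q"
    then show "A \<otimes>\<^bsub>SU_group n\<^esub> B \<in> centralizer (SU_group n) Q"
      using mult_commute_with[OF unitary_carrier unitary_carrier Q, OF SU_unitary SU_unitary, of A B]
      by (simp add: centralizer_def SU_mult)
  next
    fix A assume "A \<in> centralizer (SU_group n) Q"
    then show "inv\<^bsub>SU_group n\<^esub> A \<in> centralizer (SU_group n) Q"
      using adjoint_commute[OF SU_unitary Q, of A] by (simp add: centralizer_def inv_SU_group SU_adjoint)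
  qed (use Q in \<open>auto simp: centralizer_def SU_one\<close>)
next
  fix X A assume h: "\<forall>k. X k \<in> centralizer (SU_group n) Q" "A \<in> carrier (SU_group n)"
    "\<forall>i<n. \<forall>j<n. (\<lambda>k. X k $$ (i, j)) \<longlonglongrightarrow> A $$ (i, j)"
  show "A \<in> centralizer (SU_group n) Q"
    by (rule centralizer_closed[OF Q _ _ _, where X = X, OF subsetI]) (use h in \<open>blast intro: unitary_carrier SU_unitary\<close>)+
qed

subsection \<open>Diagonalization of antihermitian matrices\<close>

text \<open>\<open>corthogonal_inv\<close> divides each conjugated column by its squared length; for
  orthonormal columns these lengths are 1 and it becomes the adjoint. The second claim lets facts
  about \<open>corthogonal_inv\<close> be read as facts about unitary conjugation.\<close>

lemma unitary_mat_of_cols: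
  fixes ws :: "complex vec list"
  assumes "set ws \<subseteq> carrier_vec n" "length ws = n"
    and on: "\<And>i j. i < n \<Longrightarrow> j < n \<Longrightarrow> ws ! i \<bullet>c ws ! j = (if i = j then 1 else 0)"
  shows "mat_of_cols n ws \<in> carrier (U_group n)"
    "corthogonal_inv (mat_of_cols n ws) = mat_adjoint (mat_of_cols n ws)"
proof -
  have c: "ws ! i \<in> carrier_vec n" if "i < n" for i using assms that by auto
  have "mat_adjoint (mat_of_cols n ws) * mat_of_cols n ws = 1\<^sub>m n"
  proof (rule eq_matI)
    fix i j assume "i < dim_row (1\<^sub>m n :: complex mat)" "j < dim_col (1\<^sub>m n :: complex mat)"
    then have ij: "i < n" "j < n" by auto
    have "(mat_adjoint (mat_of_cols n ws) * mat_of_cols n ws) $$ (i, j) = ws ! j \<bullet>c ws ! i"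
      using ij assms(2) c[of i] c[of j]
      by (auto simp: scalar_prod_def mat_of_cols_index mult.commute intro!: sum.cong)
    then show "(mat_adjoint (mat_of_cols n ws) * mat_of_cols n ws) $$ (i, j) = 1\<^sub>m n $$ (i, j)"
      using ij by (auto simp: on)
  qed (use assms in auto)
  then show "mat_of_cols n ws \<in> carrier (U_group n)"
    using assms by (intro unitaryI) auto
  have "vec_inv w = conjugate w" if w: "w \<in> set ws" for w
  proof -
    obtain i where "i < n" "w = ws ! i" using w assms(2) by (auto simp: in_set_conv_nth)
    then show ?thesis using on[of i i] by (simp add: vec_inv_def)
  qed
  then show "corthogonal_inv (mat_of_cols n ws) = mat_adjoint (mat_of_cols n ws)"
    using assms by (auto simp: corthogonal_inv_def mat_adjoint_def cols_mat_of_cols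
      intro!: arg_cong[of _ _ "mat_of_rows n"] cong: map_cong)
qed

text \<open>An eigenvector is completed to a basis, orthogonalized with the eigenvector kept in
  first place, and normalized; the resulting vectors are the columns of \<open>W\<close>.\<close>

lemma unitary_first_column_eigenvector:
  assumes A: "A \<in> carrier_mat (Suc n) (Suc n)"
  obtains W e where "W \<in> carrier (U_group (Suc n))"
    "col (mat_adjoint W * A * W) 0 = vec (Suc n) (\<lambda>i. if i = 0 then e else 0)"
proof -
  obtain as where cp: "char_poly A = (\<Prod>a\<leftarrow>as. [:- a, 1:])"
    using char_poly_factorized[OF A] by auto
  have "degree (char_poly A) = Suc n" using degree_monic_char_poly[OF A] by simp
  then obtain e es where "as = e # es" using cp by (cases as) auto
  then have "eigenvalue A e" unfolding eigenvalue_root_char_poly[OF A] cp by simp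
  then obtain v where ev: "eigenvector A v e" by (auto simp: eigenvalue_def)
  then have v: "v \<in> carrier_vec (Suc n)" "v \<noteq> 0\<^sub>v (Suc n)" and Av: "A *\<^sub>v v = e \<cdot>\<^sub>v v"
    using A by (auto simp: eigenvector_def)
  interpret cof_vec_space "Suc n" "TYPE(complex)" .
  define b where "b = basis_completion v"
  define us where "us = gram_schmidt (Suc n) b"
  note bc = basis_completion[OF v, folded b_def]
  note gs = gram_schmidt_result[OF bc(2,4,5) refl, folded us_def]
  obtain vs where bv: "b = v # vs" using bc(6,7) by (cases b) auto
  have hd_us: "hd us = v" using gram_schmidt_hd[OF v(1), of vs, folded bv] by (simp add: us_def)
  have us: "set us \<subseteq> carrier_vec (Suc n)" "corthogonal us" "length us = Suc n"
    using gs bc(6) by auto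
  \<comment> \<open>Gram-Schmidt only makes the vectors orthogonal; dividing by the length is what
    makes \<open>W\<close> unitary.\<close>
  define f where "f w = complex_of_real (1 / sqrt (Re (w \<bullet>c w))) \<cdot>\<^sub>v w" for w :: "complex vec"
  define ws where "ws = map f us"
  have uc: "us ! i \<in> carrier_vec (Suc n)" if "i < Suc n" for i using us that by auto
  have ws: "set ws \<subseteq> carrier_vec (Suc n)" "length ws = Suc n"
    using us by (auto simp: ws_def f_def)
  have on: "ws ! i \<bullet>c ws ! j = (if i = j then 1 else 0)" if "i < Suc n" "j < Suc n" for i j
  proof -
    have "ws ! i \<bullet>c ws ! j = complex_of_real (1 / sqrt (Re (us ! i \<bullet>c us ! i)))
       * (complex_of_real (1 / sqrt (Re (us ! j \<bullet>c us ! j))) * (us ! i \<bullet>c us ! j))"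
      using that us(3) uc[of i] uc[of j] by (simp add: ws_def f_def conjugate_smult_vec)
    moreover have "us ! i \<bullet>c us ! j = 0" if "i \<noteq> j"
      using corthogonalD[OF us(2)] that \<open>i < Suc n\<close> \<open>j < Suc n\<close> us(3) by auto
    moreover have "us ! i \<bullet>c us ! i = complex_of_real (Re (us ! i \<bullet>c us ! i))" "Re (us ! i \<bullet>c us ! i) > 0"
    proof -
      have "us ! i \<bullet>c us ! i \<noteq> 0" using corthogonalD[OF us(2), of i i] us(3) that by auto
      moreover have "us ! i \<bullet>c us ! i \<ge> 0" by (rule conjugate_square_ge_0_vec)
      ultimately show "us ! i \<bullet>c us ! i = complex_of_real (Re (us ! i \<bullet>c us ! i))" "Re (us ! i \<bullet>c us ! i) > 0"
        by (auto simp: less_eq_complex_def complex_eq_iff)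
    qed
    moreover have "complex_of_real (1 / sqrt r) * (complex_of_real (1 / sqrt r) * complex_of_real r) = 1"
      if "r > 0" for r
      using that by (simp flip: of_real_mult)
    ultimately show ?thesis by (metis mult_zero_right)
  qed
  define W where "W = mat_of_cols (Suc n) ws"
  have W: "W \<in> carrier (U_group (Suc n))" "corthogonal_inv W = mat_adjoint W"
    unfolding W_def by (rule unitary_mat_of_cols[OF ws on]; assumption)+
  have hd_ws: "hd ws = f v" using hd_us us(3) by (cases us) (auto simp: ws_def)
  have v0: "f v \<noteq> 0\<^sub>v (Suc n)"
    using on[of 0 0] hd_ws ws by (cases ws) (auto simp: scalar_prod_def)
  have fv: "f v \<in> carrier_vec (Suc n)" using v by (auto simp: f_def)
  have eig: "A *\<^sub>v f v = e \<cdot>\<^sub>v f v"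
    using A v Av by (simp add: f_def mult_mat_vec smult_smult_assoc mult.commute)
  have "corthogonal ws" using on ws(2) by (intro corthogonalI) auto
  with corthogonal_col_ev_0[OF A fv v0 eig _ hd_ws ws(1) _ ws(2), folded W_def, unfolded W(2)]
  show thesis using that[OF W(1)] by auto
qed

lemma unitary_four_block:
  assumes "A \<in> carrier (U_group p)" "B \<in> carrier (U_group q)"
  shows "four_block_mat A (0\<^sub>m p q) (0\<^sub>m q p) B \<in> carrier (U_group (p + q))"
    "mat_adjoint (four_block_mat A (0\<^sub>m p q) (0\<^sub>m q p) B)
      = four_block_mat (mat_adjoint A) (0\<^sub>m p q) (0\<^sub>m q p) (mat_adjoint B)"
proof -
  note AB = assms[THEN unitary_carrier]
  show adj: "mat_adjoint (four_block_mat A (0\<^sub>m p q) (0\<^sub>m q p) B)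
      = four_block_mat (mat_adjoint A) (0\<^sub>m p q) (0\<^sub>m q p) (mat_adjoint B)"
    by (rule eq_matI) (use AB in auto)
  show "four_block_mat A (0\<^sub>m p q) (0\<^sub>m q p) B \<in> carrier (U_group (p + q))"
    by (rule unitaryI, unfold adj)
      (use AB assms in \<open>auto simp: mult_four_block_mat[of _ p p _ q _ q _ _ p _ q] four_block_one_mat\<close>)
qed

text \<open>Induction by deflation: once the first column is \<open>e\<close> times a basis vector,
  antihermitian symmetry clears the first row as well and makes \<open>e\<close> imaginary, so a
  smaller antihermitian block remains.\<close>

theorem antihermitian_diagonalizable:
  assumes "A \<in> carrier_mat n n" "mat_adjoint A = - A"
  shows "\<exists>U d. U \<in> carrier (U_group n)
    \<and> A = U * mat_diag n (\<lambda>i. \<i> * complex_of_real (d i)) * mat_adjoint U"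
  using assms
proof (induction n arbitrary: A)
  case 0
  then show ?case by (intro exI[of _ "1\<^sub>m 0"] exI) (auto simp: unitary_one)
next
  case (Suc n)
  obtain W e where W: "W \<in> carrier (U_group (Suc n))"
    and col0: "col (mat_adjoint W * A * W) 0 = vec (Suc n) (\<lambda>i. if i = 0 then e else 0)"
    using unitary_first_column_eigenvector[OF Suc.prems(1)] by metis
  define B where "B = mat_adjoint W * A * W"
  have Wc: "W \<in> carrier_mat (Suc n) (Suc n)" using unitary_carrier[OF W] .
  have Bc: "B \<in> carrier_mat (Suc n) (Suc n)" using Wc Suc.prems by (simp add: B_def mult_carrier_mat[of _ "Suc n" "Suc n"])
  have adjB: "mat_adjoint B = - B"
    using Wc Suc.prems
    by (simp add: B_def adjoint_mult[of _ "Suc n" "Suc n" _ "Suc n"] assoc_mult_mat[of _ "Suc n" "Suc n" _ "Suc n" _ "Suc n"] mult_carrier_mat[of _ "Suc n" "Suc n"])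
  have B_cnj: "cnj (B $$ (j, i)) = - B $$ (i, j)" if "i < Suc n" "j < Suc n" for i j
    using arg_cong[OF adjB, of "\<lambda>M. M $$ (i, j)"] Bc that by simp
  have B0: "B $$ (i, 0) = (if i = 0 then e else 0)" if "i < Suc n" for i
    using arg_cong[OF col0[folded B_def], of "\<lambda>v. v $ i"] Bc that by simp
  have B0': "B $$ (0, i) = (if i = 0 then e else 0)" if "i < Suc n" for i
    using B_cnj[of 0 i] B0[of i] B0[of 0] that by (cases "i = 0") auto
  have e: "e = \<i> * complex_of_real (Im e)"
    using B_cnj[of 0 0] B0[of 0] by (auto simp: complex_eq_iff)
  define C where "C = mat n n (\<lambda>(i, j). B $$ (Suc i, Suc j))"
  have C: "C \<in> carrier_mat n n" "mat_adjoint C = - C"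
    by (simp_all add: C_def) (rule eq_matI; simp add: B_cnj)
  obtain U d where U: "U \<in> carrier (U_group n)"
    and CU: "C = U * mat_diag n (\<lambda>i. \<i> * complex_of_real (d i)) * mat_adjoint U"
    using Suc.IH[OF C] by blast
  define U' where "U' = four_block_mat (1\<^sub>m 1) (0\<^sub>m 1 n) (0\<^sub>m n 1) U"
  define d' where "d' i = (case i of 0 \<Rightarrow> Im e | Suc i \<Rightarrow> d i)" for i
  let ?D = "mat_diag (Suc n) (\<lambda>i. \<i> * complex_of_real (d' i))"
  have U': "U' \<in> carrier (U_group (Suc n))"
    "mat_adjoint U' = four_block_mat (1\<^sub>m 1) (0\<^sub>m 1 n) (0\<^sub>m n 1) (mat_adjoint U)"
    using unitary_four_block[OF unitary_one U, of 1] by (simp_all add: U'_def)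
  have BC: "B = four_block_mat (mat 1 1 (\<lambda>_. e)) (0\<^sub>m 1 n) (0\<^sub>m n 1) C"
    by (rule eq_matI) (use Bc in \<open>auto simp: C_def B0 B0'\<close>)
  have D: "?D = four_block_mat (mat 1 1 (\<lambda>_. e)) (0\<^sub>m 1 n) (0\<^sub>m n 1) (mat_diag n (\<lambda>i. \<i> * complex_of_real (d i)))"
    using e by (intro eq_matI) (auto simp: d'_def mat_diag_def split: nat.splits)
  have "B = U' * ?D * mat_adjoint U'"
    using U unitary_carrier[OF U] unfolding U'(2) unfolding D U'_def BC CU
    by (simp add: mult_four_block_mat[of _ 1 1 _ n _ n _ _ 1 _ n] mult_carrier_mat[of _ n n]
        left_mult_zero_mat[of _ n n] right_mult_zero_mat[of _ n n] del: One_nat_def)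
  moreover have "A = W * B * mat_adjoint W"
    using Wc W Suc.prems
    by (simp add: B_def assoc_mult_mat[of _ "Suc n" "Suc n" _ "Suc n" _ "Suc n"] mult_carrier_mat[of _ "Suc n" "Suc n"] unitary_cancel[where k = "Suc n"])
  ultimately have "A = (W * U') * ?D * mat_adjoint (W * U')"
    using Wc unitary_carrier[OF U'(1)]
    by (simp add: adjoint_mult[of _ "Suc n" "Suc n" _ "Suc n"] assoc_mult_mat[of _ "Suc n" "Suc n" _ "Suc n" _ "Suc n"] mult_carrier_mat[of _ "Suc n" "Suc n"])
  then show ?case using unitary_mult[OF W U'(1)] by blast
qed

subsection \<open>Lie algebras of centralizers\<close>

lemma unitary_diag_index:
  assumes "U \<in> carrier_mat n n" "i < n" "j < n"
  shows "(U * mat_diag n f * mat_adjoint U) $$ (i, j) = (\<Sum>a<n. U $$ (i, a) * f a * cnj (U $$ (j, a)))"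
  using assms
  by (subst index_mult_sum[of _ n n _ n]) (auto simp: mat_diag_mult_right[of U n n])

text \<open>In the eigenbasis commutation reads \<open>(f i - f j) * M_ij = 0\<close>. The criterion
  involves \<open>f\<close> only through coincidences among its values, so it passes from the
  eigenvalues of a matrix to functions of them.\<close>

lemma commute_unitary_diag_iff:
  assumes U: "U \<in> carrier (U_group n)" and Q: "Q \<in> carrier_mat n n"
  shows "U * mat_diag n f * mat_adjoint U * Q = Q * (U * mat_diag n f * mat_adjoint U) \<longleftrightarrow>
    (\<forall>i<n. \<forall>j<n. f i = f j \<or> (mat_adjoint U * Q * U) $$ (i, j) = 0)"
proof -
  note [simp] = assoc_mult_mat[of _ n n _ n _ n] mult_carrier_mat[of _ n n] unitary_cancel[where k = n]
  have Uc: "U \<in> carrier_mat n n" using unitary_carrier[OF U] .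
  define D where "D = mat_diag n f"
  define M where "M = mat_adjoint U * Q * U"
  have D: "D \<in> carrier_mat n n" by (simp add: D_def)
  have M: "M \<in> carrier_mat n n" using Uc Q by (simp add: M_def)
  have "U * D * mat_adjoint U * Q = Q * (U * D * mat_adjoint U) \<longleftrightarrow> D * M = M * D"
  proof
    assume *: "U * D * mat_adjoint U * Q = Q * (U * D * mat_adjoint U)"
    have "D * M = mat_adjoint U * (U * D * mat_adjoint U * Q) * U"
      using U Uc Q D by (simp add: M_def)
    also have "\<dots> = M * D" unfolding * using U Uc Q D by (simp add: M_def)
    finally show "D * M = M * D" .
  next
    assume *: "D * M = M * D"
    have "U * D * mat_adjoint U * Q = U * (D * M) * mat_adjoint U"
      using U Uc Q D by (simp add: M_def)
    also have "\<dots> = Q * (U * D * mat_adjoint U)" unfolding * using U Uc Q D by (simp add: M_def)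
    finally show "U * D * mat_adjoint U * Q = Q * (U * D * mat_adjoint U)" .
  qed
  also have "\<dots> \<longleftrightarrow> (\<forall>i<n. \<forall>j<n. (D * M) $$ (i, j) = (M * D) $$ (i, j))"
    using D M by (auto simp del: assoc_mult_mat index_mult_mat(1) intro!: eq_matI)
  also have "\<dots> \<longleftrightarrow> (\<forall>i<n. \<forall>j<n. f i = f j \<or> M $$ (i, j) = 0)"
    using M by (auto simp: D_def mat_diag_mult_left[of M n n] mat_diag_mult_right[of M n n])
  finally show ?thesis by (simp only: D_def M_def)
qed

text \<open>The curve is the one-parameter group \<open>exp (t X)\<close>. Commutation with
  \<open>Q\<close> passes from \<open>X\<close> to the curve because equal eigenvalues have equal
  exponentials.\<close>

lemma lie_algebra_centralizer:
  assumes Q: "Q \<in> carrier_mat n n"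
    and X: "X \<in> carrier_mat n n" "mat_adjoint X = - X" "X * Q = Q * X"
  shows "X \<in> lie_algebra n (centralizer (U_group n) Q)"
    and "mat_trace X = 0 \<Longrightarrow> X \<in> lie_algebra n (centralizer (SU_group n) Q)"
proof -
  obtain U d where U: "U \<in> carrier (U_group n)"
    and XU: "X = U * mat_diag n (\<lambda>a. \<i> * complex_of_real (d a)) * mat_adjoint U"
    using antihermitian_diagonalizable[OF X(1,2)] by blast
  have Uc: "U \<in> carrier_mat n n" using unitary_carrier[OF U] .
  \<comment> \<open>Exponentiating the eigenvalues avoids a matrix exponential: every entry of the
    curve is a finite sum of scalar exponentials, which is differentiated termwise.\<close>
  define e where "e t a = exp (\<i> * complex_of_real (d a) * complex_of_real t)" for t a
  define \<gamma> where "\<gamma> t = U * mat_diag n (e t) * mat_adjoint U" for t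
  define \<gamma>' where "\<gamma>' t = U * mat_diag n (\<lambda>a. \<i> * complex_of_real (d a) * e t a) * mat_adjoint U" for t
  have e0: "e 0 = (\<lambda>a. 1)" by (simp add: e_def fun_eq_iff)
  have comm: "\<forall>i<n. \<forall>j<n. d i = d j \<or> (mat_adjoint U * Q * U) $$ (i, j) = 0"
    using X(3) unfolding XU commute_unitary_diag_iff[OF U Q] by auto
  have diagU: "mat_diag n (e t) \<in> carrier (U_group n)" for t
  proof -
    have "cnj (e t a) * e t a = 1" for a
    proof -
      have "e t a = cis (d a * t)" by (simp add: e_def cis_conv_exp mult.assoc)
      then show ?thesis by (simp add: cis_cnj cis_mult)
    qed
    then show ?thesis by (intro unitaryI) (auto simp: adjoint_diag)
  qed
  then have \<gamma>U: "\<gamma> t \<in> carrier (U_group n)" for t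
    unfolding \<gamma>_def by (intro unitary_mult unitary_adjoint U)
  have "\<gamma> t * Q = Q * \<gamma> t" for t
    using comm unfolding \<gamma>_def commute_unitary_diag_iff[OF U Q] e_def by metis
  then have \<gamma>Q: "\<gamma> t \<in> centralizer (U_group n) Q" for t
    using \<gamma>U by (simp add: centralizer_def)
  have \<gamma>0: "\<gamma> 0 = 1\<^sub>m n" using U Uc by (simp add: \<gamma>_def e0)
  have \<gamma>'0: "\<gamma>' 0 = X" by (simp add: \<gamma>'_def XU e0)
  have de: "((\<lambda>s. e s a) has_vector_derivative \<i> * complex_of_real (d a) * e t a) (at t)" for a t
    unfolding e_def
    by (rule has_vector_derivative_real_field) (auto intro!: derivative_eq_intros)
  have D: "((\<lambda>s. \<gamma> s $$ (i, j)) has_vector_derivative \<gamma>' t $$ (i, j)) (at t)" if "i < n" "j < n" for i j t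
    unfolding \<gamma>_def \<gamma>'_def unitary_diag_index[OF Uc that]
    by (intro has_vector_derivative_sum has_vector_derivative_mult_left has_vector_derivative_mult_right de)
  have cont: "continuous_on UNIV (\<lambda>t. \<gamma>' t $$ (i, j))" if "i < n" "j < n" for i j
    unfolding \<gamma>'_def unitary_diag_index[OF Uc that] e_def by (intro continuous_intros)
  show "X \<in> lie_algebra n (centralizer (U_group n) Q)"
    unfolding lie_algebra_def using X(1) \<gamma>Q \<gamma>0 \<gamma>'0 D cont by blast
  assume "mat_trace X = 0"
  then have "(\<Sum>a<n. \<i> * complex_of_real (d a)) = 0"
  proof -
    have "mat_trace X = mat_trace (mat_adjoint U * (U * mat_diag n (\<lambda>a. \<i> * complex_of_real (d a))))"
      unfolding XU using Uc by (intro trace_mult_commute[of _ n n]) auto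
    also have "\<dots> = (\<Sum>a<n. \<i> * complex_of_real (d a))"
      using U by (subst unitary_cancel[of U n _ n]) (auto simp: mat_trace_def mat_diag_def)
    finally show ?thesis using \<open>mat_trace X = 0\<close> by simp
  qed
  \<comment> \<open>This is \<open>det (exp (t X)) = exp (t * trace X)\<close>, evaluated at trace
    zero.\<close>
  then have "(\<Prod>a<n. e t a) = 1" for t
    unfolding e_def by (simp flip: exp_sum sum_distrib_right)
  moreover have "det (\<gamma> t) = det (mat_diag n (e t))" for t
    using Uc det_unitary[OF U] det_mult[of "U * mat_diag n (e t)" n "mat_adjoint U"]
      det_mult[of U n "mat_diag n (e t)"] by (simp add: \<gamma>_def ac_simps)
  ultimately have "\<gamma> t \<in> centralizer (SU_group n) Q" for t
    using \<gamma>Q[of t] by (simp add: centralizer_def mem_SU_iff det_diag)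
  then show "X \<in> lie_algebra n (centralizer (SU_group n) Q)"
    unfolding lie_algebra_def using X(1) \<gamma>0 \<gamma>'0 D cont by blast
qed

text \<open>Through this case \<open>lie_algebra_centralizer\<close> also supplies tangent vectors
  of the full groups.\<close>

lemma centralizer_one: "carrier G \<subseteq> carrier_mat n n \<Longrightarrow> centralizer G (1\<^sub>m n) = carrier G"
  by (auto simp: centralizer_def)

subsection \<open>Bivectors and centralizers of hermitian projections\<close>

lemma centralizerD:
  assumes "k \<in> centralizer G Q"
  shows "k \<in> carrier G" "k * Q = Q * k"
  using assms by (auto simp: centralizer_def)

text \<open>The Lie algebra of SU(n), described by equations. It is used for U(n) too, since the
  standard bivector is built from traceless matrices.\<close>

definition su_algebra :: "nat \<Rightarrow> complex mat set" where
  "su_algebra n = {X \<in> carrier_mat n n. mat_adjoint X = - X \<and> mat_trace X = 0}"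

text \<open>By \<open>real_functional_trace\<close> below, these are all the real functionals; conjugations and
  projections acting on functionals thereby become operations on matrices.\<close>

definition trace_functional :: "complex mat \<Rightarrow> complex mat \<Rightarrow> real" where
  "trace_functional G X = Re (mat_trace (mat_adjoint G * X))"

lemma trace_adjoint_mult:
  assumes "G \<in> carrier_mat n n" "X \<in> carrier_mat n n"
  shows "mat_trace (mat_adjoint G * X) = (\<Sum>p\<in>{..<n} \<times> {..<n}. cnj (G $$ p) * X $$ p)"
proof -
  have "mat_trace (mat_adjoint G * X) = (\<Sum>j<n. \<Sum>i<n. cnj (G $$ (i, j)) * X $$ (i, j))"
    using assms by (auto simp: mat_trace_def scalar_prod_def lessThan_atLeast0 intro!: sum.cong)
  also have "\<dots> = (\<Sum>i<n. \<Sum>j<n. cnj (G $$ (i, j)) * X $$ (i, j))" by (rule sum.swap)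
  finally show ?thesis by (simp add: sum.cartesian_product split_def)
qed

text \<open>The entry of \<open>G\<close> at \<open>p\<close> has as real and imaginary part the
  values of the functional at the matrices with single entry 1 and \<i> at \<open>p\<close>; this
  matches \<open>Re (cnj g * x) = Re g * Re x + Im g * Im x\<close>.\<close>

lemma real_functional_trace:
  assumes \<phi>: "real_functional n \<phi>"
  obtains G where "G \<in> carrier_mat n n" "\<And>X. X \<in> carrier_mat n n \<Longrightarrow> \<phi> X = trace_functional G X"
proof -
  define u where "u z p = mat n n (\<lambda>q. if q = p then z else 0)" for z :: complex and p :: "nat \<times> nat"
  define G where "G = mat n n (\<lambda>p. Complex (\<phi> (u 1 p)) (\<phi> (u \<i> p)))"
  have u: "u z p \<in> carrier_mat n n" for z p by (simp add: u_def)
  have add: "\<phi> (X + Y) = \<phi> X + \<phi> Y" if "X \<in> carrier_mat n n" "Y \<in> carrier_mat n n" for X Y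
    using \<phi> that by (simp add: real_functional_def)
  have scale: "\<phi> (complex_of_real a \<cdot>\<^sub>m X) = a * \<phi> X" if "X \<in> carrier_mat n n" for a X
    using \<phi> that by (simp add: real_functional_def)
  have \<phi>u: "\<phi> (u z p) = Re z * \<phi> (u 1 p) + Im z * \<phi> (u \<i> p)" for z p
  proof -
    have "u z p = complex_of_real (Re z) \<cdot>\<^sub>m u 1 p + complex_of_real (Im z) \<cdot>\<^sub>m u \<i> p"
      by (rule eq_matI) (auto simp: u_def complex_eq_iff)
    then show ?thesis using u by (simp add: add scale)
  qed
  \<comment> \<open>The entries of \<open>X\<close> are switched on one position at a time. The base
    case obtains the value at the zero matrix from scaling by 0.\<close>
  have *: "\<phi> (mat n n (\<lambda>p. if p \<in> S then X $$ p else 0)) = (\<Sum>p\<in>S. \<phi> (u (X $$ p) p))"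
    if "finite S" for X S using that
  proof (induction S)
    case empty
    have "\<phi> (complex_of_real 0 \<cdot>\<^sub>m (0\<^sub>m n n)) = 0" by (subst scale) auto
    then show ?case by (simp add: zero_mat_def smult_mat_def map_mat_def)
  next
    case (insert p S)
    have "mat n n (\<lambda>q. if q \<in> insert p S then X $$ q else 0)
      = u (X $$ p) p + mat n n (\<lambda>q. if q \<in> S then X $$ q else 0)"
      using insert by (intro eq_matI) (auto simp: u_def)
    then show ?case using insert u by (simp add: add)
  qed
  show thesis
  proof (rule that)
    show G: "G \<in> carrier_mat n n" by (simp add: G_def)
    fix X :: "complex mat" assume X: "X \<in> carrier_mat n n"
    have "X = mat n n (\<lambda>p. if p \<in> {..<n} \<times> {..<n} then X $$ p else 0)"
      using X by (intro eq_matI) auto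
    then have "\<phi> X = (\<Sum>p\<in>{..<n} \<times> {..<n}. \<phi> (u (X $$ p) p))" using *[of "{..<n} \<times> {..<n}" X] by simp
    also have "\<dots> = trace_functional G X"
      unfolding trace_functional_def trace_adjoint_mult[OF G X] Re_sum
      by (intro sum.cong refl, subst \<phi>u) (auto simp: G_def)
    finally show "\<phi> X = trace_functional G X" .
  qed
qed

section \<open>The standard bivector evaluated at trace functionals\<close>

lemma matrix_unit_dim [simp]: "dim_row (matrix_unit n i j) = n" "dim_col (matrix_unit n i j) = n"
  by (simp_all add: matrix_unit_def)

lemma cnj_matrix_unit:
  "a < n \<Longrightarrow> b < n \<Longrightarrow> cnj (matrix_unit n i j $$ (a, b)) = matrix_unit n j i $$ (b, a)"
  by (simp add: matrix_unit_def)

lemma matrix_unit_index: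
  "p \<in> {..<n} \<times> {..<n} \<Longrightarrow> matrix_unit n (Suc i) (Suc j) $$ p = (if p = (i, j) then 1 else 0)"
  by (cases p) (simp add: matrix_unit_def)

lemma X_index:
  assumes "a < n" "b < n"
  shows "X_plus n i j $$ (a, b) = \<i> * (matrix_unit n i j $$ (a, b) + matrix_unit n j i $$ (a, b))"
    and "X_minus n i j $$ (a, b) = matrix_unit n i j $$ (a, b) - matrix_unit n j i $$ (a, b)"
  using assms by (simp_all add: X_plus_def X_minus_def)

lemma X_dim [simp]:
  "dim_row (X_plus n i j) = n" "dim_col (X_plus n i j) = n"
  "dim_row (X_minus n i j) = n" "dim_col (X_minus n i j) = n"
  by (simp_all add: X_plus_def X_minus_def)

lemma X_carrier [simp]: "X_plus n i j \<in> carrier_mat n n" "X_minus n i j \<in> carrier_mat n n"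
  by (simp_all add: carrier_matI)

lemma X_su_algebra:
  assumes "i \<noteq> j"
  shows "X_plus n i j \<in> su_algebra n" "X_minus n i j \<in> su_algebra n"
proof -
  have "mat_adjoint (X_plus n i j) = - X_plus n i j" "mat_adjoint (X_minus n i j) = - X_minus n i j"
    by (rule eq_matI; simp add: X_index cnj_matrix_unit algebra_simps)+
  moreover have "matrix_unit n i j $$ (a, a) = 0" "matrix_unit n j i $$ (a, a) = 0" if "a < n" for a
    using that assms by (simp_all add: matrix_unit_def)
  then have "mat_trace (X_plus n i j) = 0" "mat_trace (X_minus n i j) = 0"
    unfolding mat_trace_def by (simp_all add: X_index)
  ultimately show "X_plus n i j \<in> su_algebra n" "X_minus n i j \<in> su_algebra n"
    by (simp_all add: su_algebra_def)
qed

text \<open>Antihermitian matrices are orthogonal to hermitian ones under the real trace pairing, so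
  only \<open>G - mat_adjoint G\<close> is visible: \<open>X_minus\<close> reads the real part of
  its entry, \<open>X_plus\<close> the imaginary part.\<close>

lemma trace_functional_X:
  assumes G: "G \<in> carrier_mat n n" and "i < n" "j < n"
  shows "trace_functional G (X_minus n (Suc i) (Suc j)) = Re ((G - mat_adjoint G) $$ (i, j))"
    and "trace_functional G (X_plus n (Suc i) (Suc j)) = Im ((G - mat_adjoint G) $$ (i, j))"
proof -
  let ?I = "{..<n} \<times> {..<n}"
  have *: "(\<Sum>p\<in>?I. f p * matrix_unit n (Suc k) (Suc l) $$ p) = f (k, l)" if "k < n" "l < n" for f k l
  proof -
    have "(\<Sum>p\<in>?I. f p * matrix_unit n (Suc k) (Suc l) $$ p) = (\<Sum>p\<in>?I. if p = (k, l) then f p else 0)"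
      by (rule sum.cong[OF refl]) (simp add: matrix_unit_index)
    then show ?thesis using that by simp
  qed
  have "mat_trace (mat_adjoint G * X_minus n (Suc i) (Suc j))
    = (\<Sum>p\<in>?I. cnj (G $$ p) * matrix_unit n (Suc i) (Suc j) $$ p
       - cnj (G $$ p) * matrix_unit n (Suc j) (Suc i) $$ p)"
    unfolding trace_adjoint_mult[OF G X_carrier(2)]
    by (rule sum.cong[OF refl]) (auto simp: X_index algebra_simps)
  also have "\<dots> = cnj (G $$ (i, j)) - cnj (G $$ (j, i))"
    unfolding sum_subtractf using assms by (simp only: *)
  finally show "trace_functional G (X_minus n (Suc i) (Suc j)) = Re ((G - mat_adjoint G) $$ (i, j))"
    using assms by (simp add: trace_functional_def)
  have "mat_trace (mat_adjoint G * X_plus n (Suc i) (Suc j))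
    = (\<Sum>p\<in>?I. (\<i> * cnj (G $$ p)) * matrix_unit n (Suc i) (Suc j) $$ p
       + (\<i> * cnj (G $$ p)) * matrix_unit n (Suc j) (Suc i) $$ p)"
    unfolding trace_adjoint_mult[OF G X_carrier(1)]
    by (rule sum.cong[OF refl]) (auto simp: X_index algebra_simps)
  also have "\<dots> = \<i> * cnj (G $$ (i, j)) + \<i> * cnj (G $$ (j, i))"
    unfolding sum.distrib using assms by (simp only: *)
  finally show "trace_functional G (X_plus n (Suc i) (Suc j)) = Im ((G - mat_adjoint G) $$ (i, j))"
    using assms by (simp add: trace_functional_def)
qed

definition index_pairs :: "nat \<Rightarrow> (nat \<times> nat) set" where
  "index_pairs n = {(i, j). 1 \<le> i \<and> i < j \<and> j \<le> n}"

lemma finite_index_pairs [simp]: "finite (index_pairs n)"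
  by (rule finite_subset[of _ "{..n} \<times> {..n}"]) (auto simp: index_pairs_def)

lemma sum_index_pairs:
  "(\<Sum>(i, j)\<in>index_pairs n. f i j) = (\<Sum>i<n. \<Sum>j\<in>{i<..<n}. f (Suc i) (Suc j))"
proof -
  have "(\<Sum>i<n. \<Sum>j\<in>{i<..<n}. f (Suc i) (Suc j))
    = (\<Sum>(i, j)\<in>(SIGMA i:{..<n}. {i<..<n}). f (Suc i) (Suc j))"
    by (rule sum.Sigma) auto
  also have "\<dots> = (\<Sum>(i, j)\<in>index_pairs n. f i j)"
    by (rule sum.reindex_bij_witness[of _ "\<lambda>(i, j). (i - 1, j - 1)" "\<lambda>(i, j). (Suc i, Suc j)"])
      (auto simp: index_pairs_def)
  finally show ?thesis by simp
qed

text \<open>The value of the standard bivector at the functionals represented by \<open>G\<close> and \<open>H\<close> is this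
  form at the antihermitian matrices \<open>G - G\<^sup>*\<close> and \<open>H - H\<^sup>*\<close>.\<close>

definition triangle_form :: "nat \<Rightarrow> complex mat \<Rightarrow> complex mat \<Rightarrow> real" where
  "triangle_form n P P' = (\<Sum>i<n. \<Sum>j\<in>{i<..<n}. Im (P $$ (i, j) * cnj (P' $$ (i, j))))"

text \<open>Each wedge contributes \<open>Im z * Re w - Re z * Im w = Im (z * cnj w)\<close>, with
  \<open>z\<close> and \<open>w\<close> the entries of the two antihermitian matrices.\<close>

lemma sum_trace_functional_X:
  assumes "G \<in> carrier_mat n n" "H \<in> carrier_mat n n"
  shows "(\<Sum>(i, j)\<in>index_pairs n.
      trace_functional G (X_plus n i j) * trace_functional H (X_minus n i j)
      - trace_functional G (X_minus n i j) * trace_functional H (X_plus n i j))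
    = triangle_form n (G - mat_adjoint G) (H - mat_adjoint H)"
  unfolding sum_index_pairs triangle_form_def
  using assms by (intro sum.cong refl) (simp add: trace_functional_X algebra_simps)

lemma sum_bivector_apply: "(\<Sum>x\<in>S. f x :: bivector) \<phi> \<psi> = (\<Sum>x\<in>S. f x \<phi> \<psi>)"
  by (induction S rule: infinite_finite_induct) auto

text \<open>Both sides are 0 off the linear functionals, but \<open>wedge\<close> tests the composed
  arguments; the assumption ensures that this inner test succeeds.\<close>

lemma push_bivector_wedge:
  assumes "\<And>\<phi>. real_functional n \<phi> \<Longrightarrow> real_functional n (\<phi> \<circ> f)"
  shows "push_bivector n f (wedge n x y) = wedge n (f x) (f y)"
  using assms by (auto simp: push_bivector_def wedge_def fun_eq_iff)

lemma push_bivector_linear: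
  "push_bivector n f (\<Sum>x\<in>S. b x) = (\<Sum>x\<in>S. push_bivector n f (b x))"
  "push_bivector n f (b1 - b2) = push_bivector n f b1 - push_bivector n f b2"
  "push_bivector n f (bivector_scale a b1) = bivector_scale a (push_bivector n f b1)"
  by (auto simp: push_bivector_def fun_eq_iff bivector_scale_def sum_bivector_apply)

lemma real_functional_mult_left:
  "A \<in> carrier_mat n n \<Longrightarrow> real_functional n \<phi> \<Longrightarrow> real_functional n (\<phi> \<circ> (\<lambda>X. A * X))"
  by (auto simp: real_functional_def mult_add_distrib_mat[of _ n n _ n] mult_smult_distrib[of _ n n _ n])

lemma real_functional_mult_right:
  "A \<in> carrier_mat n n \<Longrightarrow> real_functional n \<phi> \<Longrightarrow> real_functional n (\<phi> \<circ> (\<lambda>X. X * A))"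
  by (auto simp: real_functional_def add_mult_distrib_mat[of _ n n _ _ n] mult_smult_assoc_mat[of _ n n _ n])

text \<open>Since \<open>X * k = k * (mat_adjoint k * X * k)\<close>, right translation by
  \<open>k\<close> is left translation after conjugation by the inverse, so \<open>k\<close> can be
  pulled out on the left.\<close>

lemma standard_poisson_left_translate:
  assumes k: "k \<in> carrier (U_group n)"
  shows "standard_poisson \<kappa> n k = L_trans n k (bivector_scale \<kappa> (\<Sum>(i, j)\<in>index_pairs n.
    wedge n (X_plus n i j) (X_minus n i j)
    - wedge n (mat_adjoint k * X_plus n i j * k) (mat_adjoint k * X_minus n i j * k)))"
proof -
  have kc: "k \<in> carrier_mat n n" using unitary_carrier[OF k(1)] .
  have canc: "k * (mat_adjoint k * X * k) = X * k" if "X \<in> carrier_mat n n" for X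
    using k kc that by (simp add: assoc_mult_mat[of _ n n _ n _ n] unitary_cancel[where k = n])
  note push = push_bivector_wedge[OF real_functional_mult_left[OF kc]]
    push_bivector_wedge[OF real_functional_mult_right[OF kc]]
  show ?thesis
    unfolding standard_poisson_def r_standard_def L_trans_def R_trans_def index_pairs_def[symmetric]
    by (simp add: push_bivector_linear split_def push canc sum_subtractf)
qed

section \<open>Diagonal and off-diagonal parts with respect to a hermitian projection\<close>

locale hermitian_projection =
  fixes n :: nat and Q :: "complex mat"
  assumes Q [simp]: "Q \<in> carrier_mat n n" "mat_adjoint Q = Q" "Q * Q = Q"
begin

definition R where "R = 1\<^sub>m n - Q"

text \<open>The part of a matrix that anticommutes with the reflection \<open>Q - R\<close>; its complement
  commutes with \<open>Q\<close>.\<close>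

definition off where "off X = Q * X * R + R * X * Q"

lemma Q_dim [simp]: "dim_row Q = n" "dim_col Q = n"
  using carrier_matD[OF Q(1)] by simp_all

lemma mult_carrier [simp]: "A \<in> carrier_mat n n \<Longrightarrow> B \<in> carrier_mat n n \<Longrightarrow> A * B \<in> carrier_mat n n"
  by (rule mult_carrier_mat)

lemma minus_carrier [simp]: "B \<in> carrier_mat n n \<Longrightarrow> A - B \<in> carrier_mat n n"
  by (rule minus_carrier_mat)

lemma assoc [simp]:
  "A \<in> carrier_mat n n \<Longrightarrow> B \<in> carrier_mat n n \<Longrightarrow> C \<in> carrier_mat n n \<Longrightarrow> A * B * C = A * (B * C)"
  by (rule assoc_mult_mat)

lemma distrib:
  fixes A B C :: "complex mat"
  assumes "A \<in> carrier_mat n n" "B \<in> carrier_mat n n" "C \<in> carrier_mat n n"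
  shows "A * (B + C) = A * B + A * C" "(A + B) * C = A * C + B * C"
    "A * (B - C) = A * B - A * C" "(A - B) * C = A * C - B * C"
  using assms
  by (auto intro: mult_add_distrib_mat[of _ n n] add_mult_distrib_mat[of _ n n]
      mult_minus_distrib_mat[of _ n n] minus_mult_distrib_mat[of _ n n])

lemma R [simp]: "R \<in> carrier_mat n n" "mat_adjoint R = R"
  "Q * R = 0\<^sub>m n n" "R * Q = 0\<^sub>m n n" "R * R = R"
proof -
  have Q_minus: "Q - Q = 0\<^sub>m n n" by (rule eq_matI) auto
  show Rc: "R \<in> carrier_mat n n" by (simp add: R_def)
  show "mat_adjoint R = R" by (simp add: R_def adjoint_minus[of _ n n])
  show QR: "Q * R = 0\<^sub>m n n" by (simp add: R_def distrib right_mult_one_mat[OF Q(1)] Q_minus)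
  show "R * Q = 0\<^sub>m n n" by (simp add: R_def distrib left_mult_one_mat[OF Q(1)] Q_minus)
  have "R * R = 1\<^sub>m n * R - Q * R"
    using distrib(4)[OF one_carrier_mat Q(1) Rc] by (simp only: R_def)
  also have "\<dots> = R" unfolding QR left_mult_one_mat[OF Rc] using Rc by (intro eq_matI) auto
  finally show "R * R = R" .
qed

lemma R_dim [simp]: "dim_row R = n" "dim_col R = n"
  using carrier_matD[OF R(1)] by simp_all

text \<open>The simplifier brackets products to the right, where \<open>Q * Q\<close> occurs only
  inside \<open>Q * (Q * A)\<close>; these are the projection identities in that form.\<close>

lemma absorb [simp]:
  assumes A: "A \<in> carrier_mat n n"
  shows "Q * (Q * A) = Q * A" "R * (R * A) = R * A" "Q * (R * A) = 0\<^sub>m n n" "R * (Q * A) = 0\<^sub>m n n"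
  using left_mult_zero_mat[OF A, of n]
  by (simp_all only: assoc[OF Q(1) Q(1) A, symmetric] assoc[OF R(1) R(1) A, symmetric]
    assoc[OF Q(1) R(1) A, symmetric] assoc[OF R(1) Q(1) A, symmetric] Q R)

lemma off_carrier [simp]: "X \<in> carrier_mat n n \<Longrightarrow> off X \<in> carrier_mat n n"
  by (simp add: off_def)

lemma off_dim [simp]: "dim_row (off X) = n" "dim_col (off X) = n"
  by (simp_all add: off_def)

lemma off_off [simp]:
  assumes "X \<in> carrier_mat n n"
  shows "off (off X) = off X"
  using assms by (simp add: off_def distrib)

lemma adjoint_off:
  assumes "X \<in> carrier_mat n n"
  shows "mat_adjoint (off X) = off (mat_adjoint X)"
  using assms by (simp add: off_def adjoint_add[of _ n n] adjoint_mult[of _ n n _ n] comm_add_mat[of _ n n])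

lemma off_minus:
  assumes "X \<in> carrier_mat n n" "Y \<in> carrier_mat n n"
  shows "off (X - Y) = off X - off Y"
  using assms by (intro eq_matI) (auto simp: off_def distrib simp del: index_mult_mat(1))

text \<open>Expand \<open>(Q + R) * X * (Q + R)\<close> with \<open>Q + R = 1\<close>. Written this
  way, the complement of \<open>off X\<close> visibly commutes with \<open>Q\<close>.\<close>

lemma diag_part:
  assumes "X \<in> carrier_mat n n"
  shows "X - off X = Q * X * Q + R * X * R"
proof -
  have one: "Q + R = 1\<^sub>m n" by (rule eq_matI) (auto simp: R_def)
  have "X = (Q + R) * X * (Q + R)" unfolding one using assms by simp
  also have "\<dots> = (Q * X * Q + R * X * R) + off X"
    using assms by (intro eq_matI) (auto simp: distrib off_def simp del: index_mult_mat(1))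
  finally have X: "X = (Q * X * Q + R * X * R) + off X" .
  show ?thesis
    by (subst (1) X, rule eq_matI) (use assms carrier_matD[OF off_carrier[OF assms]] in \<open>auto simp del: index_mult_mat(1)\<close>)
qed

text \<open>The trace of \<open>off X\<close> vanishes by cyclicity and \<open>Q * R = 0\<close>, so
  removing \<open>off X\<close> keeps the matrix traceless.\<close>

lemma off_su_algebra:
  assumes "X \<in> su_algebra n"
  shows "off X \<in> su_algebra n" "X - off X \<in> su_algebra n" "(X - off X) * Q = Q * (X - off X)"
proof -
  have X: "X \<in> carrier_mat n n" "mat_adjoint X = - X" "mat_trace X = 0"
    using assms by (auto simp: su_algebra_def)
  have neg: "off (- X) = - off X"
    using X(1) by (intro eq_matI) (auto simp: off_def simp del: index_mult_mat(1))
  have "mat_trace (off X) = mat_trace (Q * X * R) + mat_trace (R * X * Q)"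
    using X(1) by (simp add: off_def trace_add[of _ n])
  also have "\<dots> = mat_trace (R * (Q * X)) + mat_trace (Q * (R * X))"
    using X(1) trace_mult_commute[of "Q * X" n n R] trace_mult_commute[of "R * X" n n Q] by simp
  also have "\<dots> = 0" using X(1) by (simp add: mat_trace_def)
  finally have tr: "mat_trace (off X) = 0" .
  show off: "off X \<in> su_algebra n" using X tr neg by (simp add: su_algebra_def adjoint_off)
  show "X - off X \<in> su_algebra n"
    using X tr neg carrier_matD[OF X(1)]
    by (auto simp: su_algebra_def adjoint_minus[of _ n n] adjoint_off trace_minus[of _ n] minus_carrier_mat intro!: eq_matI)
  show "(X - off X) * Q = Q * (X - off X)"
    unfolding diag_part[OF X(1)] using X(1) by (simp add: distrib)
qed

lemma su_algebra_conj:
  assumes k: "k \<in> carrier (U_group n)" and X: "X \<in> su_algebra n"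
  shows "mat_adjoint k * X * k \<in> su_algebra n"
proof -
  have kc: "k \<in> carrier_mat n n" using unitary_carrier[OF k(1)] .
  have Xc: "X \<in> carrier_mat n n" "mat_adjoint X = - X" "mat_trace X = 0" using X by (auto simp: su_algebra_def)
  have "mat_trace (mat_adjoint k * X * k) = mat_trace (k * (mat_adjoint k * X))"
    using Xc kc by (intro trace_mult_commute[of _ n n]) auto
  also have "\<dots> = 0" using k Xc by (simp add: unitary_cancel[where k = n])
  finally have "mat_trace (mat_adjoint k * X * k) = 0" .
  then show ?thesis using Xc kc by (simp add: su_algebra_def adjoint_mult[of _ n n _ n])
qed

text \<open>About \<open>\<kk>\<close> it is only required that it contain the traceless
  antihermitian matrices commuting with \<open>Q\<close>; the diagonal parts of \<open>x\<close> and
  \<open>y\<close> are of this kind.\<close>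

lemma wedge_minus_off:
  assumes x: "x \<in> su_algebra n" and y: "y \<in> su_algebra n"
    and kk: "\<And>X. X \<in> su_algebra n \<Longrightarrow> X * Q = Q * X \<Longrightarrow> X \<in> \<kk>" and gg: "su_algebra n \<subseteq> \<gg>"
  shows "wedge n x y - wedge n (off x) (off y) \<in> wedge_space n \<kk> \<gg>"
proof -
  have split: "\<phi> (X - off X) = \<phi> X - \<phi> (off X)" if \<phi>: "real_functional n \<phi>" and "X \<in> su_algebra n" for \<phi> X
  proof -
    have X: "X \<in> carrier_mat n n" "off X \<in> carrier_mat n n" using that by (auto simp: su_algebra_def)
    have "\<phi> X = \<phi> ((X - off X) + off X)" using X by (intro arg_cong[of _ _ \<phi>] eq_matI) auto
    then show ?thesis using \<phi> X by (simp add: real_functional_def minus_carrier_mat)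
  qed
  \<comment> \<open>Telescoping through \<open>wedge n (off x) y\<close>; the sign comes from moving
    the factor in \<open>\<kk>\<close> to the first place.\<close>
  have "wedge n x y - wedge n (off x) (off y) = wedge n (x - off x) y - wedge n (y - off y) (off x)"
    by (intro ext) (auto simp: wedge_def split x y algebra_simps)
  also have "\<dots> \<in> wedge_space n \<kk> \<gg>"
    unfolding wedge_space_def
    using off_su_algebra[OF x] off_su_algebra[OF y] x y gg
    by (intro bivector.span_diff bivector.span_base) (auto intro!: kk)
  finally show ?thesis .
qed

text \<open>\<open>off\<close> is self-adjoint for the trace pairing because \<open>Q\<close> and
  \<open>R\<close> are hermitian, so it can be moved from the vector to the functional.\<close>

lemma trace_functional_off:
  assumes "G \<in> carrier_mat n n" "X \<in> carrier_mat n n"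
  shows "trace_functional G (off X) = trace_functional (off G) X"
proof -
  have "mat_trace (mat_adjoint G * off X) = mat_trace ((mat_adjoint G * Q * X) * R) + mat_trace ((mat_adjoint G * R * X) * Q)"
    using assms by (simp add: off_def distrib trace_add[of _ n])
  also have "\<dots> = mat_trace (R * (mat_adjoint G * Q * X)) + mat_trace (Q * (mat_adjoint G * R * X))"
    using assms by (simp only: trace_mult_commute[of _ n n R] trace_mult_commute[of _ n n Q] mult_carrier_mat[of _ n n] adjoint_carrier Q R)
  also have "\<dots> = mat_trace (mat_adjoint (off G) * X)"
    using assms by (simp add: adjoint_off off_def[of "mat_adjoint G"] distrib trace_add[of _ n] add.commute)
  finally show ?thesis by (simp add: trace_functional_def)
qed

lemma trace_functional_conj:
  assumes "G \<in> carrier_mat n n" "X \<in> carrier_mat n n" "k \<in> carrier_mat n n"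
  shows "trace_functional G (mat_adjoint k * X * k) = trace_functional (k * G * mat_adjoint k) X"
  using assms trace_mult_commute[of "mat_adjoint G * (mat_adjoint k * X)" n n k]
  by (simp add: trace_functional_def adjoint_mult[of _ n n _ n])

lemma off_conj:
  assumes "X \<in> carrier_mat n n" and k: "k \<in> carrier (U_group n)" "k * Q = Q * k"
  shows "off (k * X * mat_adjoint k) = k * off X * mat_adjoint k"
proof -
  have kc: "k \<in> carrier_mat n n" using unitary_carrier[OF k(1)] .
  note kQ = k(2) adjoint_commute[OF k(1) Q(1) k(2)]
  have kR: "R * k = k * R" "R * mat_adjoint k = mat_adjoint k * R"
    using kc kQ by (simp_all add: R_def distrib)
  have [simp]: "Q * (k * Y) = k * (Q * Y)" "R * (k * Y) = k * (R * Y)" if "Y \<in> carrier_mat n n" for Y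
    using kc that kQ kR assoc[of Q k Y] assoc[of k Q Y] assoc[of R k Y] assoc[of k R Y] by (simp_all del: assoc)
  show ?thesis using assms(1) kc by (simp add: off_def distrib kQ(2) kR(2)[symmetric] flip: kQ(2) )
qed

section \<open>Coisotropy when the triangle form restricts to a multiple of a trace form\<close>

context
  fixes a :: real
  assumes key: "\<And>P P'. P \<in> carrier_mat n n \<Longrightarrow> P' \<in> carrier_mat n n \<Longrightarrow> mat_adjoint P = - P \<Longrightarrow>
    mat_adjoint P' = - P' \<Longrightarrow> off P = P \<Longrightarrow> off P' = P' \<Longrightarrow>
    triangle_form n P P' = a * Im (mat_trace (Q * P * mat_adjoint P'))"
begin

text \<open>\<open>key\<close> applies on both sides, since conjugation by \<open>k\<close> commutes
  with \<open>off\<close> and preserves antihermitian matrices; cyclicity of the trace then removes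
  \<open>k\<close>.\<close>

lemma triangle_form_conj:
  assumes "P \<in> carrier_mat n n" "P' \<in> carrier_mat n n" "mat_adjoint P = - P" "mat_adjoint P' = - P'"
    "off P = P" "off P' = P'" and k: "k \<in> carrier (U_group n)" "k * Q = Q * k"
  shows "triangle_form n (k * P * mat_adjoint k) (k * P' * mat_adjoint k) = triangle_form n P P'"
proof -
  have kc: "k \<in> carrier_mat n n" using unitary_carrier[OF k(1)] .
  have [simp]: "Q * (k * Y) = k * (Q * Y)" if "Y \<in> carrier_mat n n" for Y
    using kc that k(2) assoc[of Q k Y] assoc[of k Q Y] by (simp_all del: assoc)
  have adj: "mat_adjoint (k * Y * mat_adjoint k) = k * mat_adjoint Y * mat_adjoint k" if "Y \<in> carrier_mat n n" for Y
    using kc that by (simp add: adjoint_mult[of _ n n _ n])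
  have "triangle_form n (k * P * mat_adjoint k) (k * P' * mat_adjoint k)
    = a * Im (mat_trace (Q * (k * P * mat_adjoint k) * mat_adjoint (k * P' * mat_adjoint k)))"
    using assms kc by (intro key) (auto simp: adj off_conj simp del: assoc)
  also have "Q * (k * P * mat_adjoint k) * mat_adjoint (k * P' * mat_adjoint k) = (k * (Q * (P * mat_adjoint P'))) * mat_adjoint k"
    unfolding adj[OF assms(2)] using assms(1,2) kc k(1) by (simp add: unitary_cancel[where k = n])
  also have "mat_trace \<dots> = mat_trace (mat_adjoint k * (k * (Q * (P * mat_adjoint P'))))"
    using assms(1,2) kc by (intro trace_mult_commute[of _ n n]) auto
  also have "\<dots> = mat_trace (Q * P * mat_adjoint P')"
    using assms(1,2) kc k(1) by (simp add: unitary_cancel[where k = n])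
  finally show ?thesis using assms key by simp
qed

text \<open>Compared at two functionals given by \<open>G\<close> and \<open>H\<close>, both
  \<open>off\<close> and the conjugation move onto \<open>G\<close> and \<open>H\<close>, and the
  claim becomes the invariance of \<open>triangle_form\<close>.\<close>

lemma sum_wedge_off_conj:
  assumes k: "k \<in> carrier (U_group n)" "k * Q = Q * k"
  shows "(\<Sum>(i, j)\<in>index_pairs n. wedge n (off (X_plus n i j)) (off (X_minus n i j)))
    = (\<Sum>(i, j)\<in>index_pairs n. wedge n (off (mat_adjoint k * X_plus n i j * k)) (off (mat_adjoint k * X_minus n i j * k)))"
    (is "?l = ?r")
proof (intro ext)
  fix \<phi> \<psi>
  show "?l \<phi> \<psi> = ?r \<phi> \<psi>"
  proof (cases "real_functional n \<phi> \<and> real_functional n \<psi>")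
    case False
    then show ?thesis by (auto simp: sum_bivector_apply wedge_def split_def)
  next
    case True
    have kc: "k \<in> carrier_mat n n" using unitary_carrier[OF k(1)] .
    obtain G where G: "G \<in> carrier_mat n n" and \<phi>: "\<And>X. X \<in> carrier_mat n n \<Longrightarrow> \<phi> X = trace_functional G X"
      using real_functional_trace True by metis
    obtain H where H: "H \<in> carrier_mat n n" and \<psi>: "\<And>X. X \<in> carrier_mat n n \<Longrightarrow> \<psi> X = trace_functional H X"
      using real_functional_trace True by metis
    have anti: "mat_adjoint (off M - mat_adjoint (off M)) = - (off M - mat_adjoint (off M))"
      "off (off M - mat_adjoint (off M)) = off M - mat_adjoint (off M)"
      if M: "M \<in> carrier_mat n n" for M
    proof -
      have c: "off M \<in> carrier_mat n n" "off (mat_adjoint M) \<in> carrier_mat n n" using M by simp_all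
      show "mat_adjoint (off M - mat_adjoint (off M)) = - (off M - mat_adjoint (off M))"
        using c M by (auto simp: adjoint_minus[of _ n n] adjoint_off intro!: eq_matI)
      show "off (off M - mat_adjoint (off M)) = off M - mat_adjoint (off M)"
        using c M by (simp add: adjoint_off off_minus)
    qed
    have conj_minus: "k * M * mat_adjoint k - mat_adjoint (k * M * mat_adjoint k) = k * (M - mat_adjoint M) * mat_adjoint k"
      if "M \<in> carrier_mat n n" for M
      using that kc by (simp add: adjoint_mult[of _ n n _ n] distrib minus_carrier_mat)
    have "?l \<phi> \<psi> = (\<Sum>(i, j)\<in>index_pairs n.
      trace_functional (off G) (X_plus n i j) * trace_functional (off H) (X_minus n i j)
      - trace_functional (off G) (X_minus n i j) * trace_functional (off H) (X_plus n i j))"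
      using True G H by (simp add: sum_bivector_apply wedge_def split_def \<phi> \<psi> trace_functional_off)
    also have "\<dots> = triangle_form n (off G - mat_adjoint (off G)) (off H - mat_adjoint (off H))"
      using G H by (intro sum_trace_functional_X) auto
    also have "\<dots> = triangle_form n (k * (off G - mat_adjoint (off G)) * mat_adjoint k)
       (k * (off H - mat_adjoint (off H)) * mat_adjoint k)"
      using G H by (intro triangle_form_conj[symmetric] k anti) (auto simp: minus_carrier_mat)
    also have "\<dots> = (\<Sum>(i, j)\<in>index_pairs n.
      trace_functional (k * off G * mat_adjoint k) (X_plus n i j) * trace_functional (k * off H * mat_adjoint k) (X_minus n i j)
      - trace_functional (k * off G * mat_adjoint k) (X_minus n i j) * trace_functional (k * off H * mat_adjoint k) (X_plus n i j))"
      using G H kc by (subst sum_trace_functional_X) (auto simp: conj_minus simp del: assoc)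
    also have "\<dots> = ?r \<phi> \<psi>"
      using True G H kc by (simp add: sum_bivector_apply wedge_def split_def \<phi> \<psi> trace_functional_off
        trace_functional_conj del: assoc)
    finally show ?thesis .
  qed
qed

lemma standard_poisson_in_wedge_space:
  assumes k: "k \<in> carrier (U_group n)" "k * Q = Q * k"
    and kk: "\<And>X. X \<in> su_algebra n \<Longrightarrow> X * Q = Q * X \<Longrightarrow> X \<in> \<kk>" and gg: "su_algebra n \<subseteq> \<gg>"
  shows "standard_poisson \<kappa> n k \<in> L_trans n k ` wedge_space n \<kk> \<gg>"
proof -
  let ?X = "X_plus n" and ?Y = "X_minus n" and ?A = "\<lambda>X. mat_adjoint k * X * k"
  have sub: "bivector.subspace (wedge_space n \<kk> \<gg>)" by (simp add: wedge_space_def)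
  \<comment> \<open>The off-diagonal parts may be subtracted from both sums because their totals
    agree by \<open>sum_wedge_off_conj\<close>; every summand then falls under
    \<open>wedge_minus_off\<close>.\<close>
  have "(\<Sum>(i, j)\<in>index_pairs n. wedge n (?X i j) (?Y i j) - wedge n (?A (?X i j)) (?A (?Y i j)))
    = (\<Sum>(i, j)\<in>index_pairs n. wedge n (?X i j) (?Y i j) - wedge n (off (?X i j)) (off (?Y i j)))
    - (\<Sum>(i, j)\<in>index_pairs n. wedge n (?A (?X i j)) (?A (?Y i j)) - wedge n (off (?A (?X i j))) (off (?A (?Y i j))))"
    using sum_wedge_off_conj[OF k] by (simp add: split_def sum_subtractf)
  also have "\<dots> \<in> wedge_space n \<kk> \<gg>"
    by (intro bivector.subspace_diff[OF sub] bivector.subspace_sum[OF sub])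
      (auto simp: index_pairs_def intro!: wedge_minus_off kk gg su_algebra_conj k X_su_algebra)
  finally show ?thesis
    unfolding standard_poisson_left_translate[OF k(1)]
    by (intro imageI bivector.subspace_scale[OF sub])
qed

theorem coisotropic_centralizer:
  "coisotropic n (U_group n) (standard_poisson \<kappa> n) (centralizer (U_group n) Q)"
  "coisotropic n (SU_group n) (standard_poisson \<kappa> n) (centralizer (SU_group n) Q)"
proof -
  have one: "centralizer (U_group n) (1\<^sub>m n) = carrier (U_group n)"
    "centralizer (SU_group n) (1\<^sub>m n) = carrier (SU_group n)"
    by (auto intro!: centralizer_one dest: unitary_carrier SU_unitary)
  have su: "su_algebra n \<subseteq> lie_algebra n (carrier (U_group n))"
    "su_algebra n \<subseteq> lie_algebra n (carrier (SU_group n))"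
    using lie_algebra_centralizer[of "1\<^sub>m n" n] unfolding one by (auto simp: su_algebra_def)
  show "coisotropic n (U_group n) (standard_poisson \<kappa> n) (centralizer (U_group n) Q)"
    unfolding coisotropic_def
    by (intro conjI ballI closed_subgroup_centralizer_U Q standard_poisson_in_wedge_space su)
      (auto simp: su_algebra_def dest: centralizerD intro: lie_algebra_centralizer[OF Q(1)])
  show "coisotropic n (SU_group n) (standard_poisson \<kappa> n) (centralizer (SU_group n) Q)"
    unfolding coisotropic_def
    by (intro conjI ballI closed_subgroup_centralizer_SU Q standard_poisson_in_wedge_space su)
      (auto simp: su_algebra_def dest: centralizerD SU_unitary intro: lie_algebra_centralizer[OF Q(1)])
qed

end

end

subsection \<open>The rotated projection\<close>

text \<open>The reflection \<open>i \<mapsto> n - 1 - i\<close> groups the pairs \<open>i < j\<close> into the orbits listed in the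
  hypotheses; the sum is peeled from the outermost index inwards.\<close>

lemma triangle_sum_eq_0:
  fixes h :: "nat \<Rightarrow> nat \<Rightarrow> real"
  assumes m: "2 * m \<le> n"
    and corner: "\<And>a. a < m \<Longrightarrow> h a (n - 1 - a) = 0"
    and orbit: "\<And>a k. a < m \<Longrightarrow> a < k \<Longrightarrow> k < n - 1 - a \<Longrightarrow>
      (h a k + h k (n - 1 - a)) + (h a (n - 1 - k) + h (n - 1 - k) (n - 1 - a)) = 0"
    and middle: "\<And>i j. m \<le> i \<Longrightarrow> i < j \<Longrightarrow> j < n - m \<Longrightarrow> h i j = 0"
  shows "(\<Sum>i<n. \<Sum>j\<in>{i<..<n}. h i j) = 0"
proof -
  \<comment> \<open>\<open>S a\<close> runs over the pairs inside the window from \<open>a\<close>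
    to \<open>n - 1 - a\<close>; the next window drops the pairs that touch an end point.\<close>
  define S where "S a = (\<Sum>i\<in>{a..<n - a}. \<Sum>j\<in>{i<..<n - a}. h i j)" for a
  have step: "S a = S (Suc a)" if a: "a < m" for a
  proof -
    define b where "b = n - 1 - a"
    have b: "a < b" "n - a = Suc b" "n - Suc a = b" using a m by (auto simp: b_def)
    define u where "u k = h a k + h k b" for k
    have I: "{a..<Suc b} = insert a (insert b {Suc a..<b})" using b by auto
    have K: "{b<..<Suc b} = {}" by auto
    have J: "{i<..<Suc b} = insert b {i<..<b}" if "i < b" for i using that by auto
    have "S a = (\<Sum>j\<in>{a<..<Suc b}. h a j) + (\<Sum>i\<in>{Suc a..<b}. \<Sum>j\<in>{i<..<Suc b}. h i j)"
      unfolding S_def b I using b by (simp add: K)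
    also have "(\<Sum>i\<in>{Suc a..<b}. \<Sum>j\<in>{i<..<Suc b}. h i j) = (\<Sum>i\<in>{Suc a..<b}. h i b) + S (Suc a)"
      unfolding S_def b sum.distrib[symmetric] by (rule sum.cong) (auto simp: J)
    also have "(\<Sum>j\<in>{a<..<Suc b}. h a j) = (\<Sum>k\<in>{Suc a..<b}. h a k)"
      using b corner[OF a] by (simp add: J atLeastSucLessThan_greaterThanLessThan flip: b_def)
    also have "\<dots> + ((\<Sum>i\<in>{Suc a..<b}. h i b) + S (Suc a)) = (\<Sum>k\<in>{Suc a..<b}. u k) + S (Suc a)"
      by (simp add: u_def sum.distrib)
    \<comment> \<open>Reflection permutes the range, so twice the sum is a sum over orbits. This
      also covers a fixed point of the reflection, where \<open>orbit\<close> counts the same terms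
      twice.\<close>
    also have "(\<Sum>k\<in>{Suc a..<b}. u k) = 0"
    proof -
      have "(\<Sum>k\<in>{Suc a..<b}. u k) = (\<Sum>k\<in>{Suc a..<b}. u (n - 1 - k))"
        by (rule sum.reindex_bij_witness[of _ "\<lambda>k. n - 1 - k" "\<lambda>k. n - 1 - k"]) (use a m in \<open>auto simp: b_def\<close>)
      moreover have "(\<Sum>k\<in>{Suc a..<b}. u k + u (n - 1 - k)) = 0"
        by (rule sum.neutral) (use orbit[OF a] in \<open>auto simp: u_def b_def\<close>)
      ultimately show ?thesis by (simp add: sum.distrib)
    qed
    finally show ?thesis by simp
  qed
  have "S 0 = S a" if "a \<le> m" for a using that
    by (induction a) (auto simp: step)
  then have "S 0 = S m" by simp
  also have "S m = 0" unfolding S_def by (intro sum.neutral ballI) (auto intro: middle)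
  finally show ?thesis by (simp add: S_def lessThan_atLeast0)
qed

lemma mat_diag_dim_row_col [simp]: "dim_row (mat_diag n f) = n" "dim_col (mat_diag n f) = n"
  by (simp_all add: mat_diag_def)

lemma mat_sum_index: "a < n \<Longrightarrow> b < n \<Longrightarrow> mat_sum n f I $$ (a, b) = (\<Sum>i\<in>I. f i $$ (a, b))"
  by (simp add: mat_sum_def)

section \<open>The entries of \<sigma> and its unitarity\<close>

locale rotation =
  fixes n m :: nat and c :: real
  assumes m: "2 * m \<le> n" and c: "0 \<le> c" "c \<le> 1"
begin

definition d :: "nat \<Rightarrow> complex" where
  "d i = (if i < m \<or> n - m \<le> i then complex_of_real (sqrt c) else 1)"

text \<open>The antidiagonal of \<sigma>, indexed by the zero-based row, as \<open>d\<close> is its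
  diagonal. For odd \<open>n\<close> the central row has its antidiagonal position on the diagonal,
  but \<open>e\<close> vanishes there.\<close>

definition e :: "nat \<Rightarrow> complex" where
  "e i = (if i < m then - complex_of_real (sqrt (1 - c)) else
    if n - m \<le> i then complex_of_real (sqrt (1 - c)) else 0)"

definition p :: "nat \<Rightarrow> complex" where
  "p i = (if i < n - m then 1 else 0)"

abbreviation "s \<equiv> complex_of_real (sqrt (1 - c))"
abbreviation "t \<equiv> complex_of_real (sqrt c)"
abbreviation "\<sigma> \<equiv> \<sigma>_mat n c m"
abbreviation "E \<equiv> mat_diag n p"

lemma ts: "t * t = complex_of_real c" "s * s = 1 - complex_of_real c"
  using c by (simp_all flip: of_real_mult)

lemma cnj_de [simp]: "cnj (d i) = d i" "cnj (e i) = e i"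
  by (simp_all add: d_def e_def)

lemma d_reflect: "i < n \<Longrightarrow> d (n - 1 - i) = d i"
  using m by (auto simp: d_def)

lemma e_reflect: "i < n \<Longrightarrow> e (n - 1 - i) = - e i"
  using m by (auto simp: e_def)

lemma de_square: "d i * d i + e i * e i = 1"
  using ts by (auto simp: d_def e_def)

lemma mat_sum_diag_index:
  assumes "a < n" "b < n"
  shows "mat_sum n (\<lambda>i. matrix_unit n i i) I $$ (a, b) = (if a = b \<and> Suc a \<in> I \<and> finite I then 1 else 0)"
proof -
  have "mat_sum n (\<lambda>i. matrix_unit n i i) I $$ (a, b) = (\<Sum>i\<in>I. if Suc a = i then (if a = b then 1 else 0) else 0)"
    unfolding mat_sum_index[OF assms] by (rule sum.cong) (use assms in \<open>auto simp: matrix_unit_def\<close>)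
  then show ?thesis by (cases "finite I") auto
qed

lemma mat_sum_rotation_index:
  assumes "a < n" "b < n"
  shows "mat_sum n (\<lambda>i. matrix_unit n (n+1-i) i - matrix_unit n i (n+1-i)) {1..m} $$ (a, b)
    = (if b = n - 1 - a then (if b < m then 1 else 0) - (if a < m then 1 else 0) else 0)"
proof -
  have "mat_sum n (\<lambda>i. matrix_unit n (n+1-i) i - matrix_unit n i (n+1-i)) {1..m} $$ (a, b)
    = (\<Sum>i\<in>{1..m}. (if Suc b = i then (if b = n - 1 - a then 1 else 0) else 0)
      - (if Suc a = i then (if b = n - 1 - a then 1 else 0) else 0))"
    unfolding mat_sum_index[OF assms]
  proof (rule sum.cong[OF refl])
    fix i assume "i \<in> {1..m}"
    then have "matrix_unit n (n+1-i) i $$ (a, b) = (if Suc b = i then (if b = n - 1 - a then 1 else 0) else 0)"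
      "matrix_unit n i (n+1-i) $$ (a, b) = (if Suc a = i then (if b = n - 1 - a then 1 else 0) else 0)"
      using assms m by (auto simp: matrix_unit_def)
    then show "(matrix_unit n (n+1-i) i - matrix_unit n i (n+1-i)) $$ (a, b)
      = (if Suc b = i then (if b = n - 1 - a then 1 else 0) else 0)
      - (if Suc a = i then (if b = n - 1 - a then 1 else 0) else 0)"
      using assms by simp
  qed
  then show ?thesis unfolding sum_subtractf by simp
qed

lemma sigma_carrier [simp]: "\<sigma> \<in> carrier_mat n n"
  by (simp add: \<sigma>_mat_def mat_sum_def)

lemma sigma_dim [simp]: "dim_row \<sigma> = n" "dim_col \<sigma> = n"
  using carrier_matD[OF sigma_carrier] by simp_all

lemma sigma_index:
  assumes ab: "a < n" "b < n"
  shows "\<sigma> $$ (a, b) = (if b = a then d a else 0) + (if b = n - 1 - a then e a else 0)"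
proof -
  have 1: "\<sigma> $$ (a, b) = t * (mat_sum n (\<lambda>i. matrix_unit n i i) {1..m} $$ (a, b))
   + mat_sum n (\<lambda>i. matrix_unit n i i) {m+1..n-m} $$ (a, b)
   + t * mat_sum n (\<lambda>i. matrix_unit n i i) {n-m+1..n} $$ (a, b)
   + s * mat_sum n (\<lambda>i. matrix_unit n (n+1-i) i - matrix_unit n i (n+1-i)) {1..m} $$ (a, b)"
    using ab unfolding \<sigma>_mat_def by (simp add: mat_sum_def)
  have 2: "t * (mat_sum n (\<lambda>i. matrix_unit n i i) {1..m} $$ (a, b))
   + mat_sum n (\<lambda>i. matrix_unit n i i) {m+1..n-m} $$ (a, b)
   + t * mat_sum n (\<lambda>i. matrix_unit n i i) {n-m+1..n} $$ (a, b) = (if b = a then d a else 0)"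
    unfolding mat_sum_diag_index[OF ab] using ab m by (auto simp: d_def)
  have 3: "s * mat_sum n (\<lambda>i. matrix_unit n (n+1-i) i - matrix_unit n i (n+1-i)) {1..m} $$ (a, b)
    = (if b = n - 1 - a then e a else 0)"
    unfolding mat_sum_rotation_index[OF ab] using ab m by (auto simp: e_def)
  show ?thesis unfolding 1 2 3 ..
qed

lemma sigma_mult_index:
  assumes "A \<in> carrier_mat n n" "i < n" "j < n"
  shows "(\<sigma> * A) $$ (i, j) = d i * A $$ (i, j) + e i * A $$ (n - 1 - i, j)"
proof -
  have "(\<sigma> * A) $$ (i, j) = (\<Sum>l<n. (if l = i then d i * A $$ (l, j) else 0) + (if l = n - 1 - i then e i * A $$ (l, j) else 0))"
    unfolding index_mult_sum[OF sigma_carrier assms]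
    by (rule sum.cong) (use assms in \<open>auto simp: sigma_index distrib_right\<close>)
  also have "\<dots> = d i * A $$ (i, j) + e i * A $$ (n - 1 - i, j)"
    unfolding sum.distrib using assms by simp
  finally show ?thesis .
qed

lemma mult_sigma_adjoint_index:
  assumes "A \<in> carrier_mat n n" "i < n" "j < n"
  shows "(A * mat_adjoint \<sigma>) $$ (i, j) = d j * A $$ (i, j) + e j * A $$ (i, n - 1 - j)"
proof -
  have "(A * mat_adjoint \<sigma>) $$ (i, j) = (\<Sum>l<n. (if l = j then d j * A $$ (i, l) else 0) + (if l = n - 1 - j then e j * A $$ (i, l) else 0))"
    unfolding index_mult_sum[OF assms(1) adjoint_carrier[OF sigma_carrier] assms(2,3)]
    by (rule sum.cong) (use assms in \<open>auto simp: sigma_index distrib_left mult.commute\<close>)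
  also have "\<dots> = d j * A $$ (i, j) + e j * A $$ (i, n - 1 - j)"
    unfolding sum.distrib using assms by simp
  finally show ?thesis .
qed

text \<open>On the diagonal this is cosine squared plus sine squared; at reflected positions the two
  terms cancel because \<open>d\<close> is even and \<open>e\<close> is odd under
  reflection.\<close>

lemma sigma_unitary: "\<sigma> \<in> carrier (U_group n)"
proof -
  have "\<sigma> * mat_adjoint \<sigma> = 1\<^sub>m n"
  proof (rule eq_matI)
    fix i j assume "i < dim_row (1\<^sub>m n :: complex mat)" "j < dim_col (1\<^sub>m n :: complex mat)"
    then have ij: "i < n" "j < n" by auto
    have eq: "n - 1 - j = n - 1 - i \<longleftrightarrow> j = i" "n - 1 - j = i \<longleftrightarrow> j = n - 1 - i" using ij by auto
    have "(\<sigma> * mat_adjoint \<sigma>) $$ (i, j) = d j * \<sigma> $$ (i, j) + e j * \<sigma> $$ (i, n - 1 - j)"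
      using ij by (rule mult_sigma_adjoint_index[OF sigma_carrier])
    also have "\<dots> = d j * ((if j = i then d i else 0) + (if j = n - 1 - i then e i else 0))
       + e j * ((if j = n - 1 - i then d i else 0) + (if j = i then e i else 0))"
      using ij by (simp add: sigma_index eq del: One_nat_def diff_diff_left)
    also have "\<dots> = (if j = i then d i * d i + e i * e i else 0) + (if j = n - 1 - i then d j * e i + e j * d i else 0)"
      by (simp add: algebra_simps)
    also have "\<dots> = 1\<^sub>m n $$ (i, j)"
      using ij de_square[of i] d_reflect[OF ij(1)] e_reflect[OF ij(1)] by auto
    finally show "(\<sigma> * mat_adjoint \<sigma>) $$ (i, j) = 1\<^sub>m n $$ (i, j)" .
  qed auto
  then show ?thesis
    by (intro unitaryI mat_mult_left_right_inverse[of \<sigma>]) auto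
qed

section \<open>The projection and off-diagonal matrices in the rotated basis\<close>

definition Q where "Q = \<sigma> * E * mat_adjoint \<sigma>"

lemma p_simps [simp]: "p i * p i = p i" "cnj (p i) = p i"
  by (simp_all add: p_def)

sublocale hermitian_projection n Q
proof
  note [simp] = assoc_mult_mat[of _ n n _ n _ n] mult_carrier_mat[of _ n n] adjoint_mult[of _ n n _ n]
    unitary_cancel[OF sigma_unitary, of _ n]
  show "Q \<in> carrier_mat n n" by (simp add: Q_def)
  have "mat_adjoint E = E" by (simp add: adjoint_diag)
  then show "mat_adjoint Q = Q" by (simp add: Q_def)
  have "E * (E * X) = E * X" if "X \<in> carrier_mat n n" for X
    using assoc_mult_mat[of E n n E n X n] that by simp
  then show "Q * Q = Q" by (simp add: Q_def)
qed

lemma R_eq: "R = \<sigma> * mat_diag n (\<lambda>i. 1 - p i) * mat_adjoint \<sigma>"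
proof -
  have "mat_diag n (\<lambda>i. 1 - p i) = 1\<^sub>m n - E" by (rule eq_matI) (auto simp: mat_diag_def)
  then show ?thesis using sigma_unitary unfolding R_def unfolding Q_def by (simp add: distrib)
qed

text \<open>The matrix in the rotated basis, where \<open>Q\<close> becomes the diagonal projection \<open>E\<close>.\<close>

definition N where "N P = mat_adjoint \<sigma> * P * \<sigma>"

lemma N_carrier [simp]: "P \<in> carrier_mat n n \<Longrightarrow> N P \<in> carrier_mat n n"
  by (simp add: N_def)

lemma N_dim [simp]: "dim_row (N P) = n" "dim_col (N P) = n"
  by (simp_all add: N_def)

lemma N_inverse: "P \<in> carrier_mat n n \<Longrightarrow> P = \<sigma> * N P * mat_adjoint \<sigma>"
  using sigma_unitary by (simp add: N_def unitary_cancel[OF sigma_unitary, of _ n])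

text \<open>Each row of \<sigma> is supported on \<open>i\<close> and \<open>n - 1 - i\<close>, so
  only the four entries of \<open>N P\<close> at positions reflected in either index
  contribute.\<close>

lemma index_N:
  assumes "P \<in> carrier_mat n n" "i < n" "j < n"
  shows "P $$ (i, j) = d i * (d j * N P $$ (i, j) + e j * N P $$ (i, n - 1 - j))
    + e i * (d j * N P $$ (n - 1 - i, j) + e j * N P $$ (n - 1 - i, n - 1 - j))"
proof -
  have "P $$ (i, j) = (\<sigma> * (N P * mat_adjoint \<sigma>)) $$ (i, j)"
    using assms by (subst N_inverse) auto
  then show ?thesis
    using assms by (simp add: sigma_mult_index mult_sigma_adjoint_index del: index_mult_mat)
qed

lemma N_antihermitian:
  assumes "P \<in> carrier_mat n n" "mat_adjoint P = - P" "i < n" "j < n"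
  shows "N P $$ (j, i) = - cnj (N P $$ (i, j))"
proof -
  have "mat_adjoint (N P) = - N P"
    using assms by (simp add: N_def adjoint_mult[of _ n n _ n])
  from arg_cong[OF this, of "\<lambda>M. M $$ (j, i)"] show ?thesis
    using carrier_matD[OF N_carrier[OF assms(1)]] assms by simp
qed

text \<open>\<open>off P = P\<close> forces \<open>Q * P * Q\<close> and \<open>R * P * R\<close> to
  vanish; in the rotated basis these products are the two diagonal blocks of
  \<open>N P\<close>.\<close>

lemma N_block:
  assumes P: "P \<in> carrier_mat n n" "off P = P" and ij: "i < n" "j < n" "i < n - m \<longleftrightarrow> j < n - m"
  shows "N P $$ (i, j) = 0"
proof -
  note u = unitary_cancel[OF sigma_unitary, of _ n]
  have diag: "(mat_diag n f * N P * mat_diag n f) $$ (i, j) = f i * N P $$ (i, j) * f j" for f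
    using P(1) ij by (simp add: mat_diag_mult_left[of "N P" n n] mat_diag_mult_right[of _ n n])
  have "Q * off P * Q = 0\<^sub>m n n" "R * off P * R = 0\<^sub>m n n"
    using P(1) by (simp_all add: off_def distrib)
  then have z: "Q * P * Q = 0\<^sub>m n n" "R * P * R = 0\<^sub>m n n"
    by (simp_all only: P(2))
  have "E * N P * E = mat_adjoint \<sigma> * (Q * P * Q) * \<sigma>"
    using P(1) sigma_unitary by (simp add: Q_def N_def u)
  then have 1: "p i * N P $$ (i, j) * p j = 0" unfolding z using ij diag[of p] by simp
  have "mat_diag n (\<lambda>i. 1 - p i) * N P * mat_diag n (\<lambda>i. 1 - p i) = mat_adjoint \<sigma> * (R * P * R) * \<sigma>"
    using P(1) sigma_unitary by (simp add: R_eq N_def u)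
  then have 2: "(1 - p i) * N P $$ (i, j) * (1 - p j) = 0" unfolding z using ij diag[of "\<lambda>i. 1 - p i"] by simp
  show ?thesis using 1 2 ij(3) by (auto simp: p_def split: if_splits)
qed

text \<open>In the rotated basis the trace is a sum over rows below \<open>n - m\<close>. The
  vanishing blocks leave only columns from \<open>n - m\<close> on, so it can be indexed by
  \<open>i < j\<close> like \<open>triangle_form\<close> and compared orbit by orbit.\<close>

lemma trace_Q:
  assumes P: "P \<in> carrier_mat n n" "off P = P" and P': "P' \<in> carrier_mat n n"
  shows "mat_trace (Q * P * mat_adjoint P')
    = (\<Sum>i<n. \<Sum>j\<in>{i<..<n}. if i < n - m \<and> n - m \<le> j then N P $$ (i, j) * cnj (N P' $$ (i, j)) else 0)"
proof -
  have "mat_trace (Q * P * mat_adjoint P') = mat_trace (\<sigma> * (E * N P * mat_adjoint (N P') * mat_adjoint \<sigma>))"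
    using P P' sigma_unitary
    by (simp add: Q_def N_def adjoint_mult[of _ n n _ n] unitary_cancel[OF sigma_unitary, of _ n])
  also have "\<dots> = mat_trace ((E * N P * mat_adjoint (N P') * mat_adjoint \<sigma>) * \<sigma>)"
    using P P' by (intro trace_mult_commute[of _ n n]) auto
  also have "\<dots> = mat_trace (E * N P * mat_adjoint (N P'))"
    using P P' sigma_unitary by simp
  also have "\<dots> = (\<Sum>i<n. \<Sum>j<n. p i * N P $$ (i, j) * cnj (N P' $$ (i, j)))"
    using P(1) P' carrier_matD[OF N_carrier[OF P']]
    unfolding mat_trace_def
    by (intro sum.cong) (auto simp: index_mult_sum[of _ n n _ n] mat_diag_mult_left[of _ n n] simp del: index_mult_mat(1) assoc)
  also have "\<dots> = (\<Sum>i<n. \<Sum>j\<in>{i<..<n}. if i < n - m \<and> n - m \<le> j then N P $$ (i, j) * cnj (N P' $$ (i, j)) else 0)"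
  proof (rule sum.cong[OF refl])
    fix i assume i: "i \<in> {..<n}"
    \<comment> \<open>For \<open>j \<le> i\<close> either \<open>p i = 0\<close>, or both indices
      lie in the first block, where \<open>N P\<close> vanishes.\<close>
    have "(\<Sum>j<n. p i * N P $$ (i, j) * cnj (N P' $$ (i, j))) = (\<Sum>j\<in>{i<..<n}. p i * N P $$ (i, j) * cnj (N P' $$ (i, j)))"
      using i by (intro sum.mono_neutral_right) (auto simp: p_def intro!: N_block[OF P])
    also have "\<dots> = (\<Sum>j\<in>{i<..<n}. if i < n - m \<and> n - m \<le> j then N P $$ (i, j) * cnj (N P' $$ (i, j)) else 0)"
      using i by (intro sum.cong) (auto simp: p_def N_block[OF P])
    finally show "(\<Sum>j<n. p i * N P $$ (i, j) * cnj (N P' $$ (i, j)))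
      = (\<Sum>j\<in>{i<..<n}. if i < n - m \<and> n - m \<le> j then N P $$ (i, j) * cnj (N P' $$ (i, j)) else 0)" .
  qed
  finally show ?thesis .
qed

text \<open>The mixed terms come in complex conjugate pairs and drop out of the imaginary part,
  while conjugation reverses the sign of the \<open>S^2\<close> terms. It is applied with
  \<open>T = c\<close> and \<open>S = 1 - c\<close>.\<close>

lemma orbit_identity:
  fixes x y x' y' :: complex and T S :: real
  shows "Im ((T * x + S * cnj y) * cnj (T * x' + S * cnj y')) + Im ((T * y + S * cnj x) * cnj (T * y' + S * cnj x'))
    = (T^2 - S^2) * (Im (x * cnj x') + Im (y * cnj y'))"
  by (simp add: algebra_simps power2_eq_square)

text \<open>The degenerate orbit with \<open>y = x\<close>, where the mixed terms are already
  real.\<close>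

lemma corner_identity:
  fixes x x' :: complex and T S :: real
  shows "Im ((T * x + S * cnj x) * cnj (T * x' + S * cnj x')) = (T^2 - S^2) * Im (x * cnj x')"
  by (simp add: algebra_simps power2_eq_square)

text \<open>The two sides differ by a sum of \<open>h\<close> over \<open>i < j\<close>. Individual
  values of \<open>h\<close> are in general nonzero; they cancel within reflection orbits, as
  \<open>triangle_sum_eq_0\<close> requires.\<close>

lemma triangle_form_off:
  assumes P: "P \<in> carrier_mat n n" "mat_adjoint P = - P" "off P = P"
    and P': "P' \<in> carrier_mat n n" "mat_adjoint P' = - P'" "off P' = P'"
  shows "triangle_form n P P' = (2 * c - 1) * Im (mat_trace (Q * P * mat_adjoint P'))"
proof -
  define f where "f i j = Im (P $$ (i, j) * cnj (P' $$ (i, j)))" for i j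
  define w where "w i j = Im (N P $$ (i, j) * cnj (N P' $$ (i, j)))" for i j
  define g where "g i j = (if i < n - m \<and> n - m \<le> j then w i j else 0)" for i j
  define h where "h i j = f i j - (2 * c - 1) * g i j" for i j
  note bP = N_block[OF P(1,3)] and bP' = N_block[OF P'(1,3)]
  note iP = index_N[OF P(1)] and iP' = index_N[OF P'(1)]
  note aP = N_antihermitian[OF P(1,2)] and aP' = N_antihermitian[OF P'(1,2)]
  have TS: "c^2 - (1 - c)^2 = 2 * c - 1" by (simp add: power2_eq_square algebra_simps)
  have sub: "1 - complex_of_real c = complex_of_real (1 - c)" by simp
  have de: "d a = t" "e a = - s" "d (n - 1 - a) = t" "e (n - 1 - a) = s"
    "n - 1 - (n - 1 - a) = a" "a < n" "a < n - m" "n - 1 - a < n" "\<not> n - 1 - a < n - m" "n - m \<le> n - 1 - a"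
    "\<not> n - m \<le> a" if "a < m" for a
    using that m by (auto simp: d_def e_def)
  have de_mid: "d k = 1" "e k = 0" "k < n" if "m \<le> k" "k < n - m" for k
    using that m by (auto simp: d_def e_def)
  have corner: "h a (n - 1 - a) = 0" if a: "a < m" for a
  proof -
    note D = de[OF a]
    define x where "x = N P $$ (a, n - 1 - a)"
    define x' where "x' = N P' $$ (a, n - 1 - a)"
    have "P $$ (a, n - 1 - a) = t * t * x + s * s * cnj x"
      unfolding iP[OF D(6,8)] D by (simp add: bP D aP[OF D(6,8)] x_def del: diff_diff_left One_nat_def)
    moreover have "P' $$ (a, n - 1 - a) = t * t * x' + s * s * cnj x'"
      unfolding iP'[OF D(6,8)] D by (simp add: bP' D aP'[OF D(6,8)] x'_def del: diff_diff_left One_nat_def)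
    ultimately show ?thesis
      using corner_identity[of c x "1 - c" x']
      unfolding h_def f_def g_def w_def ts sub TS x_def[symmetric] x'_def[symmetric] using D by simp
  qed
  \<comment> \<open>Since \<sigma> fixes \<open>k\<close>, both entries come from one entry
    \<open>x\<close> of \<open>N P\<close>, as \<open>s * cnj x\<close> and \<open>t * x\<close>.
    The conjugate flips the sign of the imaginary part, which gives the factor
    \<open>c - (1 - c)\<close>.\<close>
  have middle_orbit: "h a k + h k (n - 1 - a) = 0" if a: "a < m" and k: "m \<le> k" "k < n - m" for a k
  proof -
    note D = de[OF a] and K = de_mid[OF k]
    define x where "x = N P $$ (k, n - 1 - a)"
    define x' where "x' = N P' $$ (k, n - 1 - a)"
    have "P $$ (a, k) = s * cnj x" "P $$ (k, n - 1 - a) = t * x"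
      unfolding iP[OF D(6) K(3)] iP[OF K(3) D(8)] D K
      by (simp_all add: bP D K k aP[OF K(3) D(8)] x_def del: diff_diff_left One_nat_def)
    moreover have "P' $$ (a, k) = s * cnj x'" "P' $$ (k, n - 1 - a) = t * x'"
      unfolding iP'[OF D(6) K(3)] iP'[OF K(3) D(8)] D K
      by (simp_all add: bP' D K k aP'[OF K(3) D(8)] x'_def del: diff_diff_left One_nat_def)
    moreover have "Im ((s * cnj x) * cnj (s * cnj x')) = (1 - c) * Im (cnj x * x')"
      "Im ((t * x) * cnj (t * x')) = c * Im (x * cnj x')"
    proof -
      have *: "(s * cnj x) * cnj (s * cnj x') = (s * s) * (cnj x * x')" "(t * x) * cnj (t * x') = (t * t) * (x * cnj x')"
        by (simp_all add: mult_ac)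
      have "Im (complex_of_real r * z) = r * Im z" for r z by simp
      then show "Im ((s * cnj x) * cnj (s * cnj x')) = (1 - c) * Im (cnj x * x')"
        "Im ((t * x) * cnj (t * x')) = c * Im (x * cnj x')"
        unfolding * ts sub by blast+
    qed
    ultimately show ?thesis
      unfolding h_def f_def g_def w_def x_def[symmetric] x'_def[symmetric] using D k by (simp add: algebra_simps)
  qed
  have side_orbit: "(h a k + h k (n - 1 - a)) + (h a (n - 1 - k) + h (n - 1 - k) (n - 1 - a)) = 0"
    if a: "a < m" and k: "k < m" for a k
  proof -
    note D = de[OF a] and K = de[OF k]
    define x where "x = N P $$ (a, n - 1 - k)"
    define x' where "x' = N P' $$ (a, n - 1 - k)"
    define y where "y = N P $$ (k, n - 1 - a)"
    define y' where "y' = N P' $$ (k, n - 1 - a)"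
    have "N P $$ (a, k) = 0" "N P $$ (k, a) = 0" "N P $$ (n - 1 - a, n - 1 - k) = 0" "N P $$ (n - 1 - k, n - 1 - a) = 0"
      using D(6-9) K(6-9) by (blast intro: bP)+
    moreover have "N P $$ (n - 1 - a, k) = - cnj y" "N P $$ (n - 1 - k, a) = - cnj x"
      unfolding x_def y_def by (rule aP[OF K(6) D(8)], rule aP[OF D(6) K(8)])
    moreover note x_def[symmetric] y_def[symmetric]
    ultimately have NP: "N P $$ (a, k) = 0" "N P $$ (k, a) = 0"
      "N P $$ (n - 1 - a, n - 1 - k) = 0" "N P $$ (n - 1 - k, n - 1 - a) = 0"
      "N P $$ (a, n - 1 - k) = x" "N P $$ (k, n - 1 - a) = y"
      "N P $$ (n - 1 - a, k) = - cnj y" "N P $$ (n - 1 - k, a) = - cnj x"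
      by blast+
    have "N P' $$ (a, k) = 0" "N P' $$ (k, a) = 0" "N P' $$ (n - 1 - a, n - 1 - k) = 0" "N P' $$ (n - 1 - k, n - 1 - a) = 0"
      using D(6-9) K(6-9) by (blast intro: bP')+
    moreover have "N P' $$ (n - 1 - a, k) = - cnj y'" "N P' $$ (n - 1 - k, a) = - cnj x'"
      unfolding x'_def y'_def by (rule aP'[OF K(6) D(8)], rule aP'[OF D(6) K(8)])
    moreover note x'_def[symmetric] y'_def[symmetric]
    ultimately have NP': "N P' $$ (a, k) = 0" "N P' $$ (k, a) = 0"
      "N P' $$ (n - 1 - a, n - 1 - k) = 0" "N P' $$ (n - 1 - k, n - 1 - a) = 0"
      "N P' $$ (a, n - 1 - k) = x'" "N P' $$ (k, n - 1 - a) = y'"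
      "N P' $$ (n - 1 - a, k) = - cnj y'" "N P' $$ (n - 1 - k, a) = - cnj x'"
      by blast+
    have PE: "P $$ (a, k) = - (t * s) * (x - cnj y)" "P $$ (n - 1 - k, n - 1 - a) = t * s * (y - cnj x)"
      "P $$ (a, n - 1 - k) = t * t * x + s * s * cnj y" "P $$ (k, n - 1 - a) = t * t * y + s * s * cnj x"
      unfolding iP[OF D(6) K(6)] iP[OF K(8) D(8)] iP[OF D(6) K(8)] iP[OF K(6) D(8)] D(1-5) K(1-5) NP
      by (simp_all add: algebra_simps)
    have PE': "P' $$ (a, k) = - (t * s) * (x' - cnj y')" "P' $$ (n - 1 - k, n - 1 - a) = t * s * (y' - cnj x')"
      "P' $$ (a, n - 1 - k) = t * t * x' + s * s * cnj y'" "P' $$ (k, n - 1 - a) = t * t * y' + s * s * cnj x'"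
      unfolding iP'[OF D(6) K(6)] iP'[OF K(8) D(8)] iP'[OF D(6) K(8)] iP'[OF K(6) D(8)] D(1-5) K(1-5) NP'
      by (simp_all add: algebra_simps)
    \<comment> \<open>The entries at these two positions are complex conjugates of each other, for
      \<open>P\<close> and for \<open>P'\<close>, so their imaginary contributions cancel.\<close>
    have "f a k + f (n - 1 - k) (n - 1 - a) = 0"
      unfolding f_def PE PE' by (simp add: algebra_simps)
    moreover have "f a (n - 1 - k) + f k (n - 1 - a) = (2 * c - 1) * (w a (n - 1 - k) + w k (n - 1 - a))"
      unfolding f_def w_def PE PE' ts sub NP NP' orbit_identity TS ..
    moreover have "g a k = 0" "g (n - 1 - k) (n - 1 - a) = 0"
      "g a (n - 1 - k) = w a (n - 1 - k)" "g k (n - 1 - a) = w k (n - 1 - a)"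
      using D(6-11) K(6-11) by (simp_all only: g_def if_True if_False simp_thms)
    ultimately show ?thesis
      unfolding h_def by (simp add: distrib_left del: diff_diff_left One_nat_def)
  qed
  have "(\<Sum>i<n. \<Sum>j\<in>{i<..<n}. h i j) = 0"
  proof (rule triangle_sum_eq_0[where h = h, OF m corner])
    fix a k assume a: "a < m" and k: "a < k" "k < n - 1 - a"
    \<comment> \<open>In the middle range each half of the orbit vanishes separately. In the last
      range the orbit is that of \<open>n - 1 - k\<close>, which lies below
      \<open>m\<close>.\<close>
    consider "k < m" | "m \<le> k" "k < n - m" | "n - m \<le> k" by linarith
    then show "(h a k + h k (n - 1 - a)) + (h a (n - 1 - k) + h (n - 1 - k) (n - 1 - a)) = 0"
    proof cases
      case 1
      then show ?thesis by (rule side_orbit[OF a])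
    next
      case 2
      then have "m \<le> n - 1 - k" "n - 1 - k < n - m" by auto
      then show ?thesis using middle_orbit[OF a 2] middle_orbit[OF a, of "n - 1 - k"] by simp
    next
      case 3
      then have "n - 1 - k < m" "n - 1 - (n - 1 - k) = k" using k by auto
      then show ?thesis using side_orbit[OF a, of "n - 1 - k"] by simp
    qed
  next
    fix i j assume ij: "m \<le> i" "i < j" "j < n - m"
    then have mid: "m \<le> i" "i < n - m" "m \<le> j" "j < n - m" by auto
    note I = de_mid[OF mid(1,2)] and J = de_mid[OF mid(3,4)]
    \<comment> \<open>\<sigma> fixes both indices, so this is an entry of \<open>N P\<close> inside
      its vanishing first block.\<close>
    have "P $$ (i, j) = 0" unfolding iP[OF I(3) J(3)] I J by (simp add: bP I J mid)
    then show "h i j = 0" using mid by (simp add: h_def f_def g_def)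
  qed
  then have "(\<Sum>i<n. \<Sum>j\<in>{i<..<n}. f i j) = (2 * c - 1) * (\<Sum>i<n. \<Sum>j\<in>{i<..<n}. g i j)"
    by (simp add: h_def sum_subtractf sum_distrib_left)
  also have "(\<Sum>i<n. \<Sum>j\<in>{i<..<n}. g i j) = Im (mat_trace (Q * P * mat_adjoint P'))"
    unfolding trace_Q[OF P(1,3) P'(1)] Im_sum by (intro sum.cong refl) (auto simp: g_def w_def)
  finally show ?thesis unfolding triangle_form_def f_def .
qed

text \<open>Commuting with \<open>E\<close> kills exactly the entries whose row and column lie in
  different blocks; for such a matrix the unitarity equation splits into one for each block.\<close>

lemma block_U_eq: "block_U n m = centralizer (U_group n) E"
proof (intro equalityI subsetI)
  have nm: "n - m + m = n" using m by simp
  fix k assume "k \<in> block_U n m"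
  then obtain A B where AB: "A \<in> carrier (U_group (n - m))" "B \<in> carrier (U_group m)"
    and k: "k = four_block_mat A (0\<^sub>m (n-m) m) (0\<^sub>m m (n-m)) B" by (auto simp: block_U_def)
  have kU: "k \<in> carrier (U_group n)" using unitary_four_block(1)[OF AB] unfolding k nm .
  have z: "k $$ (i, j) * p j = p i * k $$ (i, j)" if "i < n" "j < n" for i j
    using that carrier_matD[OF unitary_carrier[OF AB(1)]] carrier_matD[OF unitary_carrier[OF AB(2)]] m
    by (auto simp: k p_def)
  have "k * E = E * k"
    unfolding mat_diag_mult_left[OF unitary_carrier[OF kU]] mat_diag_mult_right[OF unitary_carrier[OF kU]]
    by (rule eq_matI) (use carrier_matD[OF unitary_carrier[OF kU]] in \<open>auto simp: z\<close>)
  then show "k \<in> centralizer (U_group n) E" using kU by (simp add: centralizer_def)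
next
  fix k assume k: "k \<in> centralizer (U_group n) E"
  note kU = centralizerD(1)[OF k] and comm = centralizerD(2)[OF k]
  note kc = unitary_carrier[OF kU]
  have z: "k $$ (i, j) = 0" if "i < n" "j < n" "p i \<noteq> p j" for i j
    using arg_cong[OF comm, of "\<lambda>M. M $$ (i, j)"] that
    unfolding mat_diag_mult_left[OF kc] mat_diag_mult_right[OF kc] by (simp add: mult.commute)
  define A where "A = mat (n - m) (n - m) (\<lambda>(i, j). k $$ (i, j))"
  define B where "B = mat m m (\<lambda>(i, j). k $$ (i + (n - m), j + (n - m)))"
  have AB: "A \<in> carrier_mat (n - m) (n - m)" "B \<in> carrier_mat m m" by (simp_all add: A_def B_def)
  have k_eq: "k = four_block_mat A (0\<^sub>m (n-m) m) (0\<^sub>m m (n-m)) B"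
  proof (rule eq_matI)
    fix i j assume "i < dim_row (four_block_mat A (0\<^sub>m (n-m) m) (0\<^sub>m m (n-m)) B)"
      "j < dim_col (four_block_mat A (0\<^sub>m (n-m) m) (0\<^sub>m m (n-m)) B)"
    then have "i < n" "j < n" using m by (auto simp: A_def B_def)
    then show "k $$ (i, j) = four_block_mat A (0\<^sub>m (n-m) m) (0\<^sub>m m (n-m)) B $$ (i, j)"
      using z[of i j] m by (simp add: A_def B_def p_def)
  qed (use carrier_matD[OF kc] m in \<open>simp_all add: A_def B_def\<close>)
  have adj: "mat_adjoint k = four_block_mat (mat_adjoint A) (0\<^sub>m (n-m) m) (0\<^sub>m m (n-m)) (mat_adjoint B)"
    unfolding k_eq by (rule eq_matI) (use AB in auto)
  have "mat_adjoint k * k = four_block_mat (mat_adjoint A * A) (0\<^sub>m (n-m) m) (0\<^sub>m m (n-m)) (mat_adjoint B * B)"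
    unfolding adj by (subst k_eq)
      (use AB in \<open>simp add: mult_four_block_mat[of _ "n-m" "n-m" _ m _ m _ _ "n-m" _ m]
        mult_carrier_mat[of _ "n-m" "n-m"] mult_carrier_mat[of _ m m]\<close>)
  then have one: "four_block_mat (mat_adjoint A * A) (0\<^sub>m (n-m) m) (0\<^sub>m m (n-m)) (mat_adjoint B * B) = 1\<^sub>m n"
    using kU by simp
  have "mat_adjoint A * A = 1\<^sub>m (n - m)"
  proof (rule eq_matI)
    fix i j assume "i < dim_row (1\<^sub>m (n - m) :: complex mat)" "j < dim_col (1\<^sub>m (n - m) :: complex mat)"
    then show "(mat_adjoint A * A) $$ (i, j) = 1\<^sub>m (n - m) $$ (i, j)"
      using arg_cong[OF one, of "\<lambda>M. M $$ (i, j)"] carrier_matD[OF AB(1)] carrier_matD[OF AB(2)] m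
      by (simp del: index_mult_mat(1))
  qed (use AB in auto)
  \<comment> \<open>Writing \<open>n\<close> as \<open>r + m\<close> removes truncated subtraction
    from the index shift into the lower block.\<close>
  moreover define r where "r = n - m"
  have r: "n = r + m" using m by (simp add: r_def)
  have "mat_adjoint B * B = 1\<^sub>m m"
  proof (rule eq_matI)
    fix i j assume "i < dim_row (1\<^sub>m m :: complex mat)" "j < dim_col (1\<^sub>m m :: complex mat)"
    then show "(mat_adjoint B * B) $$ (i, j) = 1\<^sub>m m $$ (i, j)"
      using arg_cong[OF one, of "\<lambda>M. M $$ (i + r, j + r)"] carrier_matD[OF AB(1)] carrier_matD[OF AB(2)]
      unfolding r_def[symmetric] by (simp add: r del: index_mult_mat(1))
  qed (use AB in auto)
  ultimately show "k \<in> block_U n m"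
    using k_eq AB unfolding block_U_def by (auto intro!: unitaryI)
qed

lemma block_SU_eq: "block_SU n m = centralizer (SU_group n) E"
  unfolding block_SU_def block_U_eq by (auto simp: centralizer_def mem_SU_iff)

text \<open>Conjugation by \<sigma> carries \<open>E\<close> to \<open>Q\<close>. Only stability of
  \<open>G\<close> under conjugation enters; for SU(n) it holds because conjugation preserves the
  determinant.\<close>

lemma Ad_centralizer:
  assumes sub: "carrier G \<subseteq> carrier_mat n n"
    and conj: "\<And>k. k \<in> carrier G \<Longrightarrow> \<sigma> * k * mat_adjoint \<sigma> \<in> carrier G \<and> mat_adjoint \<sigma> * k * \<sigma> \<in> carrier G"
  shows "Ad n \<sigma> (centralizer G E) = centralizer G Q"
proof -
  note u = unitary_cancel[OF sigma_unitary, of _ n]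
  have comm: "\<sigma> * k * mat_adjoint \<sigma> * Q = Q * (\<sigma> * k * mat_adjoint \<sigma>)"
    if "k \<in> carrier_mat n n" "k * E = E * k" for k
  proof -
    have "\<sigma> * k * mat_adjoint \<sigma> * Q = \<sigma> * (k * E) * mat_adjoint \<sigma>"
      using that(1) by (simp add: Q_def u)
    also have "\<dots> = Q * (\<sigma> * k * mat_adjoint \<sigma>)"
      using that(1) by (simp add: Q_def u that(2))
    finally show ?thesis .
  qed
  have comm': "mat_adjoint \<sigma> * k * \<sigma> * E = E * (mat_adjoint \<sigma> * k * \<sigma>)"
    if "k \<in> carrier_mat n n" "k * Q = Q * k" for k
  proof -
    have "mat_adjoint \<sigma> * k * \<sigma> * E = mat_adjoint \<sigma> * (k * Q) * \<sigma>"
      using that(1) sigma_unitary by (simp add: Q_def u)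
    also have "\<dots> = E * (mat_adjoint \<sigma> * k * \<sigma>)"
      unfolding that(2) using that(1) by (simp add: Q_def u)
    finally show ?thesis .
  qed
  show ?thesis
  proof (intro equalityI subsetI)
    fix x assume "x \<in> Ad n \<sigma> (centralizer G E)"
    then obtain k where "k \<in> centralizer G E" "x = \<sigma> * k * mat_adjoint \<sigma>"
      by (auto simp: Ad_def inv_U_group[OF sigma_unitary])
    then show "x \<in> centralizer G Q"
      using sub conj[of k] comm[of k] by (auto simp: centralizer_def simp del: assoc)
  next
    fix x assume x: "x \<in> centralizer G Q"
    then have xc: "x \<in> carrier_mat n n" using sub by (auto simp: centralizer_def)
    have "mat_adjoint \<sigma> * x * \<sigma> \<in> centralizer G E"
      using x xc conj[of x] comm'[of x] by (auto simp: centralizer_def simp del: assoc)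
    moreover have "x = \<sigma> * (mat_adjoint \<sigma> * x * \<sigma>) * mat_adjoint \<sigma>"
      using N_inverse[OF xc] by (simp only: N_def)
    ultimately show "x \<in> Ad n \<sigma> (centralizer G E)"
      unfolding Ad_def inv_U_group[OF sigma_unitary] by blast
  qed
qed

lemma Ad_block:
  "Ad n \<sigma> (block_U n m) = centralizer (U_group n) Q"
  "Ad n \<sigma> (block_SU n m) = centralizer (SU_group n) Q"
proof -
  have conj: "\<sigma> * k * mat_adjoint \<sigma> \<in> carrier (U_group n) \<and> mat_adjoint \<sigma> * k * \<sigma> \<in> carrier (U_group n)"
    if "k \<in> carrier (U_group n)" for k
    using that by (intro conjI unitary_mult unitary_adjoint sigma_unitary)
  have "det (\<sigma> * k * mat_adjoint \<sigma>) = det k \<and> det (mat_adjoint \<sigma> * k * \<sigma>) = det k"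
    if "k \<in> carrier_mat n n" for k
    using that det_unitary[OF sigma_unitary] by (simp add: det_mult[of _ n] mult_ac del: assoc)
  then have conj': "\<sigma> * k * mat_adjoint \<sigma> \<in> carrier (SU_group n) \<and> mat_adjoint \<sigma> * k * \<sigma> \<in> carrier (SU_group n)"
    if "k \<in> carrier (SU_group n)" for k
    using that conj unitary_carrier unfolding mem_SU_iff by metis
  show "Ad n \<sigma> (block_U n m) = centralizer (U_group n) Q"
    unfolding block_U_eq by (rule Ad_centralizer) (use conj in \<open>auto dest: unitary_carrier\<close>)
  show "Ad n \<sigma> (block_SU n m) = centralizer (SU_group n) Q"
    unfolding block_SU_eq by (rule Ad_centralizer) (use conj' in \<open>auto dest: SU_unitary unitary_carrier\<close>)
qed

end

theorem proposition5:
  fixes n m :: nat and c \<kappa> :: real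
  assumes "n \<ge> 4" and "m \<ge> 1" and "m \<le> n div 2" and "0 \<le> c" and "c \<le> 1" and "\<kappa> \<noteq> 0"
  shows "coisotropic n (U_group n) (standard_poisson \<kappa> n) (Ad n (\<sigma>_mat n c m) (block_U n m))
       \<and> coisotropic n (SU_group n) (standard_poisson \<kappa> n) (Ad n (\<sigma>_mat n c m) (block_SU n m))"
proof -
  interpret rotation n m c
    using assms by unfold_locales auto
  \<comment> \<open>The free constant in the coisotropy criterion becomes \<open>2 * c - 1\<close>,
    with \<open>triangle_form_off\<close> discharging its assumption \<open>key\<close>.\<close>
  show ?thesis
    unfolding Ad_block
    by (intro conjI coisotropic_centralizer[of "2 * c - 1"] triangle_form_off)
qed

end
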